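(* Let $(X^{(\varepsilon)})_{\varepsilon\ge 0}$ be an irreducibly perturbed Markov chain on a finite state space $S$, let $E_1,\dots,E_n$ be its $P_0$-essential classes, pick $x_i\in E_i$ for each $i$, and set $S_0=\{x_1,\dots,x_n\}$. Let $\hat X^{(\varepsilon)}$ be the effective metastable representation of $X^{(\varepsilon)}$ corresponding to $S_0$, with path measure $\hat{\mathbb P}_\varepsilon$ and stationary distribution $\hat\mu_\varepsilon$. Then for all $i\neq j$, $$\hat{\mathbb P}_\varepsilon^{x_i}(\tau_{x_j}^+<\tau_{x_i}^+)\simeq \hat q_\varepsilon(E_i,E_j).$$ In particular, $\hat\mu_\varepsilon(x_i)\simeq\mu_\varepsilon(E_i)$ for all $i$, where $\mu_\varepsilon$ is the stationary distribution of $X^{(\varepsilon)}$.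
   Context: Let $S$ be a finite set. For $\varepsilon\ge 0$ let $X^{(\varepsilon)}=(X^{(\varepsilon)}_n)_{n\ge 0}$ be a discrete time Markov chain on $S$ with transition matrix $P_\varepsilon=(p_\varepsilon(x,y))_{x,y\in S}$; $\mathbb P_\varepsilon^x$ is its path measure when started in $x$. The family is a perturbed Markov chain if $\lim_{\varepsilon\to0}p_\varepsilon(x,y)=p_0(x,y)$ for all $x,y\in S$, and an irreducibly perturbed Markov chain if in addition $X^{(\varepsilon)}$ is irreducible for every $\varepsilon>0$. For $\varepsilon>0$, $\mu_\varepsilon$ denotes the unique stationary distribution, and $\mu_\varepsilon(E)=\sum_{x\in E}\mu_\varepsilon(x)$. For $A\subset S$: $\tau_A=\inf\{n\ge0:X_n\in A\}$, $\tau_A^+=\inf\{n>0:X_n\in A\}$, $\tau_x=\tau_{\{x\}}$, $\tau_x^+=\tau_{\{x\}}^+$, $\inf\emptyset=\infty$; the same notation is used for every chain. An event such as $\{X_{\tau_A^+}=y\}$ includes $\tau_A^+<\infty$. The $P_0$-essential classes are the essential (closed) communicating classes of the chain with transition matrix $P_0$. For a $P_0$-essential class $E$, $\nu_E$ is the unique (strictly positive) stationary distribution of the irreducible chain on $E$ with transition matrix $(p_0(x,y))_{x,y\in E}$. The effective metastable representation of $X^{(\varepsilon)}$ corresponding to $S_0$ is the Markov chain $\hat X^{(\varepsilon)}$ on $S_0$ with transition matrix $$\hat p_\varepsilon(x_i,x_j)=\nu_{E_i}(x_i)\,\mathbb P_\varepsilon^{x_i}(X_{\tau_{S_0}^+}=x_j)\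 (i\ne j),\qquad \hat p_\varepsilon(x_i,x_i)=\nu_{E_i}(x_i)\,\mathbb P_\varepsilon^{x_i}(X_{\tau_{S_0}^+}=x_i)+1-\nu_{E_i}(x_i).$$ For distinct $P_0$-essential classes $E\neq E'$, $\hat q_\varepsilon(E,E')=\sum_{x\in E}\nu_E(x)^2\,\mathbb P_\varepsilon^x(\tau_{E'}^+<\tau_x^+)$. Asymptotic equivalence: for nonnegative functions $a_\varepsilon,b_\varepsilon$ of $\varepsilon$, $a_\varepsilon\simeq b_\varepsilon$ means that either both are identically zero, or there is $\varepsilon_0>0$ with $b_\varepsilon>0$ for all $\varepsilon\in(0,\varepsilon_0)$ and $\lim_{\varepsilon\to0}a_\varepsilon/b_\varepsilon=1$. *)

theory Defs
  imports "HOL-Probability.Probability"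
begin

section \<open>Finite Markov chains given by a transition matrix on a carrier set\<close>

definition stochastic :: "'a set \<Rightarrow> ('a \<Rightarrow> 'a \<Rightarrow> real) \<Rightarrow> bool" where
  "stochastic S P \<longleftrightarrow>
     (\<forall>x\<in>S. \<forall>y\<in>S. 0 \<le> P x y) \<and> (\<forall>x\<in>S. (\<Sum>y\<in>S. P x y) = 1)"

primrec n_step :: "'a set \<Rightarrow> ('a \<Rightarrow> 'a \<Rightarrow> real) \<Rightarrow> nat \<Rightarrow> 'a \<Rightarrow> 'a \<Rightarrow> real" where
  "n_step S P 0 x y = (if x = y then 1 else 0)"
| "n_step S P (Suc n) x y = (\<Sum>z\<in>S. P x z * n_step S P n z y)"

definition leads_to :: "'a set \<Rightarrow> ('a \<Rightarrow> 'a \<Rightarrow> real) \<Rightarrow> 'a \<Rightarrow> 'a \<Rightarrow> bool" where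
  "leads_to S P x y \<longleftrightarrow> (\<exists>n. 0 < n_step S P n x y)"

definition irreducible_chain :: "'a set \<Rightarrow> ('a \<Rightarrow> 'a \<Rightarrow> real) \<Rightarrow> bool" where
  "irreducible_chain S P \<longleftrightarrow> (\<forall>x\<in>S. \<forall>y\<in>S. leads_to S P x y)"

definition comm_class :: "'a set \<Rightarrow> ('a \<Rightarrow> 'a \<Rightarrow> real) \<Rightarrow> 'a \<Rightarrow> 'a set" where
  "comm_class S P x = {y \<in> S. leads_to S P x y \<and> leads_to S P y x}"

definition essential_classes :: "'a set \<Rightarrow> ('a \<Rightarrow> 'a \<Rightarrow> real) \<Rightarrow> 'a set set" where
  "essential_classes S P =
     {C \<in> comm_class S P ` S. \<forall>x\<in>C. \<forall>y\<in>S. leads_to S P x y \<longrightarrow> y \<in> C}"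

definition stationary :: "'a set \<Rightarrow> ('a \<Rightarrow> 'a \<Rightarrow> real) \<Rightarrow> ('a \<Rightarrow> real) \<Rightarrow> bool" where
  "stationary S P \<mu> \<longleftrightarrow>
     (\<forall>x\<in>S. 0 \<le> \<mu> x) \<and> (\<Sum>x\<in>S. \<mu> x) = 1 \<and> (\<forall>y\<in>S. (\<Sum>x\<in>S. \<mu> x * P x y) = \<mu> y)"

text \<open>
  Only the values on \<open>S\<close> are meaningful; they are set to \<open>0\<close> elsewhere so that uniqueness of the
  stationary distribution on \<open>S\<close> gives uniqueness as a HOL function.
\<close>
definition stat_dist :: "'a set \<Rightarrow> ('a \<Rightarrow> 'a \<Rightarrow> real) \<Rightarrow> 'a \<Rightarrow> real" where
  "stat_dist S P = (THE \<mu>. stationary S P \<mu> \<and> (\<forall>x. x \<notin> S \<longrightarrow> \<mu> x = 0))"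


section \<open>Path measure\<close>

text \<open>
  Conditional law of the state at time \<open>n\<close> given the history \<open>\<omega>\<close> at the times \<open>0, \<dots>, n - 1\<close>, for the
  chain started in \<open>x\<close>. The path measure is the measure on \<open>nat \<Rightarrow> 'a\<close> that the Ionescu-Tulcea
  theorem builds from these kernels; see \<open>measure_path_cylinder\<close> below.
\<close>
definition chain_kernel ::
  "'a set \<Rightarrow> ('a \<Rightarrow> 'a \<Rightarrow> real) \<Rightarrow> 'a \<Rightarrow> nat \<Rightarrow> (nat \<Rightarrow> 'a) \<Rightarrow> 'a measure" where
  "chain_kernel S P x n \<omega> = point_measure S
     (\<lambda>y. case n of 0 \<Rightarrow> (if y = x then 1 else 0) | Suc m \<Rightarrow> ennreal (P (\<omega> m) y))"

definition path_measure ::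
  "'a set \<Rightarrow> ('a \<Rightarrow> 'a \<Rightarrow> real) \<Rightarrow> 'a \<Rightarrow> (nat \<Rightarrow> 'a) measure" where
  "path_measure S P x =
     projective_family.lim UNIV
       (Ionescu_Tulcea.CI (chain_kernel S P x) (\<lambda>_. count_space S)) (\<lambda>_. count_space S)"

lemma Ionescu_Tulcea_chain:
  assumes S: "finite S" and P: "stochastic S P" and x: "x \<in> S"
  shows "Ionescu_Tulcea (chain_kernel S P x) (\<lambda>_. count_space S)"
proof (rule Ionescu_Tulcea.intro)
  have prob: "prob_space (chain_kernel S P x n \<omega>)"
    if \<omega>: "\<omega> \<in> space (PiM {0..<n} (\<lambda>_. count_space S))" for n \<omega>
  proof (rule prob_spaceI, cases n)
    case 0
    then show "emeasure (chain_kernel S P x n \<omega>) (space (chain_kernel S P x n \<omega>)) = 1"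
      using S x by (simp add: chain_kernel_def space_point_measure emeasure_point_measure_finite)
  next
    case (Suc m)
    with \<omega> have "\<omega> m \<in> S"
      by (auto simp: space_PiM PiE_iff)
    with P S Suc show "emeasure (chain_kernel S P x n \<omega>) (space (chain_kernel S P x n \<omega>)) = 1"
      by (simp add: chain_kernel_def space_point_measure emeasure_point_measure_finite
          stochastic_def)
  qed
  then show "prob_space (chain_kernel S P x n \<omega>)"
    if "\<omega> \<in> space (PiM {0..<n} (\<lambda>_. count_space S))" for n \<omega>
    using that by blast
  have sets_kernel: "sets (chain_kernel S P x n \<omega>) = Pow S" for n \<omega>
    by (simp add: chain_kernel_def sets_point_measure)
  show "chain_kernel S P x n \<in> measurable (PiM {0..<n} (\<lambda>_. count_space S))
      (subprob_algebra (count_space S))" for n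
  proof (rule measurable_subprob_algebra)
    fix A assume A: "A \<in> sets (count_space S)"
    have *: "emeasure (chain_kernel S P x n \<omega>) A =
        (\<Sum>y\<in>A. case n of 0 \<Rightarrow> (if y = x then 1 else 0) | Suc m \<Rightarrow> ennreal (P (\<omega> m) y))" for \<omega>
      using A S by (simp add: chain_kernel_def emeasure_point_measure_finite)
    have [measurable]:
      "(\<lambda>\<omega>. ennreal (P (\<omega> m) y)) \<in> borel_measurable (PiM {0..<Suc m} (\<lambda>_. count_space S))" for m y
    proof (rule measurable_compose[where g = "\<lambda>s. ennreal (P s y)"])
      show "(\<lambda>\<omega>. \<omega> m) \<in> measurable (PiM {0..<Suc m} (\<lambda>_. count_space S)) (count_space S)"
        by (rule measurable_component_singleton) simp
    qed simp
    show "(\<lambda>\<omega>. emeasure (chain_kernel S P x n \<omega>) A)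
        \<in> borel_measurable (PiM {0..<n} (\<lambda>_. count_space S))"
      unfolding * by (cases n) (auto intro!: borel_measurable_sum)
  qed (auto intro: prob_space_imp_subprob_space prob simp: sets_kernel)
qed

lemma sets_path_measure:
  assumes "finite S" "stochastic S P" "x \<in> S"
  shows "sets (path_measure S P x) = sets (PiM UNIV (\<lambda>_. count_space S))"
proof -
  interpret IT: Ionescu_Tulcea "chain_kernel S P x" "\<lambda>_. count_space S"
    using assms by (rule Ionescu_Tulcea_chain)
  show ?thesis
    by (simp add: path_measure_def)
qed

lemma prob_space_path_measure:
  assumes "finite S" "stochastic S P" "x \<in> S"
  shows "prob_space (path_measure S P x)"
proof -
  interpret IT: Ionescu_Tulcea "chain_kernel S P x" "\<lambda>_. count_space S"
    using assms by (rule Ionescu_Tulcea_chain)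
  have "emeasure (path_measure S P x) (prod_emb UNIV (\<lambda>_. count_space S) {} (space (PiM {} (\<lambda>_. count_space S))))
      = emeasure (IT.CI {}) (space (PiM {} (\<lambda>_. count_space S)))"
    unfolding path_measure_def by (rule IT.lim) auto
  also have "\<dots> = 1"
    using prob_space.emeasure_space_1[OF IT.PF.prob_space_P[of "{}"]] by (simp add: IT.PF.space_P)
  also have "prod_emb UNIV (\<lambda>_. count_space S) {} (space (PiM {} (\<lambda>_. count_space S)))
      = space (path_measure S P x)"
    unfolding sets_eq_imp_space_eq[OF sets_path_measure[OF assms]]
    by (auto simp: prod_emb_def space_PiM)
  finally show ?thesis
    by (rule prob_spaceI)
qed

lemma measure_path_cylinder:
  assumes S: "finite S" and P: "stochastic S P" and x: "x \<in> S" and w: "\<And>i. i \<le> n \<Longrightarrow> w i \<in> S"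
  shows "\<P>(\<omega> in path_measure S P x. \<forall>i\<le>n. \<omega> i = w i) =
    (if w 0 = x then 1 else 0) * (\<Prod>i<n. P (w i) (w (Suc i)))"
proof -
  interpret IT: Ionescu_Tulcea "chain_kernel S P x" "\<lambda>_. count_space S"
    using S P x by (rule Ionescu_Tulcea_chain)
  let ?M = "\<lambda>_::nat. count_space S"
  let ?u = "\<lambda>_::nat. undefined :: 'a"
  let ?X = "\<lambda>n. PiE {0..<n} (\<lambda>i. {w i})"
  have X: "?X m \<in> sets (PiM {0..<m} ?M)" if "\<And>i. i < m \<Longrightarrow> w i \<in> S" for m
    using that by (intro sets_PiM_I_finite) auto
  have C: "emeasure (IT.C 0 (Suc k) ?u) (?X (Suc k)) =
      ennreal ((if w 0 = x then 1 else 0) * (\<Prod>i<k. P (w i) (w (Suc i))))" if "k \<le> n" for k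
    using that
  proof (induction k)
    case 0
    have "emeasure (IT.C 0 (Suc 0) ?u) (?X (Suc 0)) = emeasure (IT.eP 0 ?u) (?X (Suc 0))"
      using bind_return[of "IT.eP 0" "PiM {} ?M" "PiM {0..<Suc 0} ?M" ?u] IT.measurable_eP[of 0]
      by (simp add: space_PiM)
    also have "\<dots> = emeasure (chain_kernel S P x 0 ?u) (fun_upd ?u 0 -` ?X (Suc 0) \<inter> S)"
      using w[of 0] by (subst IT.emeasure_eP) (auto intro!: X simp: space_PiM)
    also have "fun_upd ?u 0 -` ?X (Suc 0) \<inter> S = {w 0}"
      using w[of 0] by (fastforce simp: PiE_iff extensional_def)
    finally show ?case
      using S w[of 0] by (simp add: chain_kernel_def emeasure_point_measure_finite)
  next
    case (Suc k)
    let ?C = "IT.C 0 (Suc k) ?u"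
    have spC: "space ?C = space (PiM {0..<Suc k} ?M)"
      by (subst IT.space_C) (auto simp: space_PiM)
    have wk: "w k \<in> S" "w (Suc k) \<in> S" and Pk: "0 \<le> P (w k) (w (Suc k))"
      using w Suc.prems P by (auto simp: stochastic_def)
    have "emeasure (IT.C 0 (Suc (Suc k)) ?u) (?X (Suc (Suc k))) =
        (\<integral>\<^sup>+\<omega>. emeasure (IT.eP (Suc k) \<omega>) (?X (Suc (Suc k))) \<partial>?C)"
    proof -
      have "IT.eP (Suc k) \<in> measurable ?C (subprob_algebra (PiM {0..<Suc (Suc k)} ?M))"
        using IT.measurable_eP[of "Suc k"] IT.sets_C[of ?u 0 "Suc k"]
        by (simp add: space_PiM cong: measurable_cong_sets)
      moreover have "space ?C \<noteq> {}"
        using prob_space.not_empty[OF IT.prob_space_C[of ?u 0 "Suc k"]] by (simp add: space_PiM)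
      ultimately show ?thesis
        using Suc.prems w
        by (subst IT.C.simps(2), subst emeasure_bind) (auto intro!: X)
    qed
    also have "\<dots> = (\<integral>\<^sup>+\<omega>. ennreal (P (w k) (w (Suc k))) * indicator (?X (Suc k)) \<omega> \<partial>?C)"
    proof (rule nn_integral_cong)
      fix \<omega> assume "\<omega> \<in> space ?C"
      then have \<omega>: "\<omega> \<in> space (PiM {0..<Suc k} ?M)" by (simp only: spC)
      then have ext: "\<omega> \<in> extensional {0..<Suc k}" by (auto simp: space_PiM PiE_iff)
      have "emeasure (IT.eP (Suc k) \<omega>) (?X (Suc (Suc k))) =
          emeasure (chain_kernel S P x (Suc k) \<omega>)
            (fun_upd \<omega> (Suc k) -` ?X (Suc (Suc k)) \<inter> S)"
        using Suc.prems w by (subst IT.emeasure_eP[OF \<omega>]) (auto intro!: X)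
      also have "fun_upd \<omega> (Suc k) -` ?X (Suc (Suc k)) \<inter> S =
          (if \<omega> \<in> ?X (Suc k) then {w (Suc k)} else {})"
        using ext wk by (auto simp: PiE_iff extensional_def atLeast0_lessThan_Suc split: if_splits)
      also have "emeasure (chain_kernel S P x (Suc k) \<omega>) \<dots> =
          ennreal (P (w k) (w (Suc k))) * indicator (?X (Suc k)) \<omega>"
        using S wk by (auto simp: chain_kernel_def emeasure_point_measure_finite PiE_iff)
      finally show "emeasure (IT.eP (Suc k) \<omega>) (?X (Suc (Suc k))) = \<dots>" .
    qed
    also have "\<dots> = ennreal (P (w k) (w (Suc k))) * emeasure ?C (?X (Suc k))"
    proof (rule nn_integral_cmult_indicator)
      show "?X (Suc k) \<in> sets ?C"
        using X[of "Suc k"] IT.sets_C[of ?u 0 "Suc k"] w Suc.prems by (simp add: space_PiM)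
    qed
    also have "\<dots> = ennreal ((if w 0 = x then 1 else 0) * (\<Prod>i<Suc k. P (w i) (w (Suc i))))"
      using Suc Pk by (simp add: ennreal_mult' mult_ac del: IT.C.simps)
    finally show ?case .
  qed
  have "{\<omega> \<in> space (path_measure S P x). \<forall>i\<le>n. \<omega> i = w i} =
      prod_emb UNIV ?M {0..<Suc n} (?X (Suc n))"
    unfolding sets_eq_imp_space_eq[OF sets_path_measure[OF S P x]]
    by (auto simp: prod_emb_def space_PiM PiE_iff less_Suc_eq_le)
  then have "emeasure (path_measure S P x) {\<omega> \<in> space (path_measure S P x). \<forall>i\<le>n. \<omega> i = w i} =
      emeasure (IT.CI {0..<Suc n}) (?X (Suc n))"
    using w by (simp add: path_measure_def IT.lim X)
  also have "\<dots> = emeasure (IT.C 0 (Suc n) ?u) (?X (Suc n))"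
  proof -
    have "prod_emb {0..<Suc n} ?M {0..<Suc n} (?X (Suc n)) = ?X (Suc n)"
      using w by (intro prod_emb_id) (auto simp: PiE_iff)
    then show ?thesis
      using w by (subst IT.emeasure_CI[of _ "Suc n"]) (auto intro!: X simp del: IT.C.simps)
  qed
  also note C[OF order_refl]
  finally have "emeasure (path_measure S P x) {\<omega> \<in> space (path_measure S P x). \<forall>i\<le>n. \<omega> i = w i} =
      ennreal ((if w 0 = x then 1 else 0) * (\<Prod>i<n. P (w i) (w (Suc i))))" .
  moreover have "0 \<le> (\<Prod>i<n. P (w i) (w (Suc i)))"
    using P w by (intro prod_nonneg) (simp add: stochastic_def)
  ultimately show ?thesis
    by (simp add: measure_def)
qed


section \<open>Hitting times\<close>

text \<open>The infimum is taken in \<open>enat\<close>, so it is \<open>\<infinity>\<close> for a path that does not visit \<open>A\<close> at a positive time.\<close>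
definition hit_pos :: "'a set \<Rightarrow> (nat \<Rightarrow> 'a) \<Rightarrow> enat" where
  "hit_pos A \<omega> = Inf {enat n | n. 0 < n \<and> \<omega> n \<in> A}"

text \<open>Probability of the event \<open>X\<^bsub>\<tau>\<^esub> = y\<close>, \<open>\<tau> < \<infinity>\<close>, where \<open>\<tau>\<close> is the positive hitting time of \<open>A\<close>.\<close>
definition hit_prob ::
  "'a set \<Rightarrow> ('a \<Rightarrow> 'a \<Rightarrow> real) \<Rightarrow> 'a \<Rightarrow> 'a set \<Rightarrow> 'a \<Rightarrow> real" where
  "hit_prob S P x A y =
     \<P>(\<omega> in path_measure S P x. hit_pos A \<omega> < \<infinity> \<and> \<omega> (the_enat (hit_pos A \<omega>)) = y)"

definition hit_before_prob ::
  "'a set \<Rightarrow> ('a \<Rightarrow> 'a \<Rightarrow> real) \<Rightarrow> 'a \<Rightarrow> 'a set \<Rightarrow> 'a set \<Rightarrow> real" where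
  "hit_before_prob S P x A B = \<P>(\<omega> in path_measure S P x. hit_pos A \<omega> < hit_pos B \<omega>)"


section \<open>Perturbed Markov chains\<close>

definition perturbed_chain :: "'a set \<Rightarrow> (real \<Rightarrow> 'a \<Rightarrow> 'a \<Rightarrow> real) \<Rightarrow> bool" where
  "perturbed_chain S P \<longleftrightarrow>
     finite S \<and> (\<forall>\<epsilon>\<ge>0. stochastic S (P \<epsilon>)) \<and>
     (\<forall>x\<in>S. \<forall>y\<in>S. ((\<lambda>\<epsilon>. P \<epsilon> x y) \<longlongrightarrow> P 0 x y) (at_right 0))"

definition irreducibly_perturbed_chain :: "'a set \<Rightarrow> (real \<Rightarrow> 'a \<Rightarrow> 'a \<Rightarrow> real) \<Rightarrow> bool" where
  "irreducibly_perturbed_chain S P \<longleftrightarrow>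
     perturbed_chain S P \<and> (\<forall>\<epsilon>>0. irreducible_chain S (P \<epsilon>))"

text \<open>
  In the next two definitions \<open>P0\<close> is the unperturbed matrix and \<open>P\<close> the matrix \<open>P\<^sub>\<epsilon>\<close> for one \<open>\<epsilon>\<close>.
  The stationary distribution \<open>\<nu>\<^sub>E\<close> of a \<open>P0\<close>-essential class \<open>E\<close> is \<open>stat_dist E P0\<close>, and the class
  containing \<open>u\<close> is \<open>comm_class S P0 u\<close>.
\<close>
definition eff_repr ::
  "'a set \<Rightarrow> ('a \<Rightarrow> 'a \<Rightarrow> real) \<Rightarrow> ('a \<Rightarrow> 'a \<Rightarrow> real) \<Rightarrow> 'a set \<Rightarrow> 'a \<Rightarrow> 'a \<Rightarrow> real" where
  "eff_repr S P0 P S0 u v =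
     (let \<nu> = stat_dist (comm_class S P0 u) P0 u
      in \<nu> * hit_prob S P u S0 v + (if u = v then 1 - \<nu> else 0))"

definition eff_rate ::
  "'a set \<Rightarrow> ('a \<Rightarrow> 'a \<Rightarrow> real) \<Rightarrow> ('a \<Rightarrow> 'a \<Rightarrow> real) \<Rightarrow> 'a set \<Rightarrow> 'a set \<Rightarrow> real" where
  "eff_rate S P0 P E E' = (\<Sum>x\<in>E. (stat_dist E P0 x)\<^sup>2 * hit_before_prob S P x E' {x})"

text \<open>Functions of \<open>\<epsilon>\<close> are compared for \<open>\<epsilon> > 0\<close> only; their value at \<open>\<epsilon> = 0\<close> plays no role.\<close>
definition asymp_eq :: "(real \<Rightarrow> real) \<Rightarrow> (real \<Rightarrow> real) \<Rightarrow> bool" (infix \<open>\<simeq>\<close> 50) where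
  "a \<simeq> b \<longleftrightarrow>
     (\<forall>\<epsilon>>0. a \<epsilon> = 0 \<and> b \<epsilon> = 0) \<or>
     (\<exists>\<epsilon>0>0. \<forall>\<epsilon>\<in>{0<..<\<epsilon>0}. 0 < b \<epsilon>) \<and> ((\<lambda>\<epsilon>. a \<epsilon> / b \<epsilon>) \<longlongrightarrow> 1) (at_right 0)"

end

theory Submission
  imports Defs
begin

text \<open>
  The hitting probabilities are the unique solutions of their one-step equations. Slowing the trace
  chain on \<open>S\<^sub>0\<close> down at \<open>x\<^sub>i\<close> by the factor \<open>\<nu>(x\<^sub>i)\<close> multiplies escape probabilities from \<open>x\<^sub>i\<close> by
  \<open>\<nu>(x\<^sub>i)\<close> and divides the invariant measure by it, so for each \<open>\<epsilon>\<close> both sides can be expressed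
  through \<open>X\<^sup>\<epsilon>\<close>. Since the chain equilibrates inside an essential class before it leaves, hitting a
  class is asymptotically the same as hitting any given point of it, and \<open>\<mu>\<^sub>\<epsilon>\<close> conditioned on a class
  \<open>E\<close> tends to \<open>\<nu>\<^sub>E\<close>. With the identity
  \<open>\<mu>(x) P\<^sup>x(\<tau>\<^sub>z < \<tau>\<^sub>x) = \<mu>(z) P\<^sup>z(\<tau>\<^sub>x < \<tau>\<^sub>z)\<close> for positive hitting times, valid without reversibility,
  \<open>\<nu>\<^sub>E(x)\<close> times the escape probability from \<open>x\<close> does not depend on \<open>x \<in> E\<close> asymptotically, and
  \<open>\<Sum>\<^sub>x \<nu>\<^sub>E(x) = 1\<close> gives the first claim.
\<close>

section \<open>Path measure and hitting probabilities\<close>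

lemma measurable_path_coord:
  assumes "finite S" "stochastic S P" "x \<in> S"
  shows "(\<lambda>\<omega>. \<omega> i) \<in> measurable (path_measure S P x) (count_space S)"
proof -
  have "(\<lambda>\<omega>. \<omega> i) \<in> measurable (PiM UNIV (\<lambda>_::nat. count_space S)) (count_space S)"
    by (rule measurable_component_singleton) simp
  then show ?thesis
    using sets_path_measure[OF assms] by (simp cong: measurable_cong_sets)
qed

lemma pred_path_coord:
  assumes "finite S" "stochastic S P" "x \<in> S"
  shows "Measurable.pred (path_measure S P x) (\<lambda>\<omega>. Q (\<omega> i))"
  by (rule measurable_compose[OF measurable_path_coord[OF assms]]) simp

lemma path_coord_in:
  assumes "finite S" "stochastic S P" "x \<in> S" "\<omega> \<in> space (path_measure S P x)"
  shows "\<omega> i \<in> S"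
  using measurable_space[OF measurable_path_coord[OF assms(1-3)] assms(4)] by simp

section \<open>Taboo probabilities and entry probabilities\<close>

lemma measure_path_split:
  assumes S: "finite S" "stochastic S P" "x \<in> S"
    and Q [measurable]: "Measurable.pred (path_measure S P x) Q"
  shows "\<P>(\<omega> in path_measure S P x. Q \<omega>) = (\<Sum>z\<in>S. \<P>(\<omega> in path_measure S P x. \<omega> k = z \<and> Q \<omega>))"
proof -
  let ?M = "path_measure S P x"
  interpret prob_space ?M by (rule prob_space_path_measure[OF S])
  note [measurable] = pred_path_coord[OF S]
  have "{\<omega>\<in>space ?M. Q \<omega>} = (\<Union>z\<in>S. {\<omega>\<in>space ?M. \<omega> k = z \<and> Q \<omega>})"
    using path_coord_in[OF S] by auto
  then show ?thesis
    using S(1) by (simp only:)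
      (subst finite_measure_finite_Union, auto simp: disjoint_family_on_def)
qed

text \<open>Taboo probabilities in the sense of Chung: \<open>C\<close> is forbidden at the times
  \<open>1..n\<close> and \<open>D\<close> is tested at time \<open>Suc n\<close>. The starting
  point is exempt from the taboo, as it is for positive hitting times.\<close>

primrec taboo_prob ::
  "'a set \<Rightarrow> ('a \<Rightarrow> 'a \<Rightarrow> real) \<Rightarrow> 'a set \<Rightarrow> 'a set \<Rightarrow> nat \<Rightarrow> 'a \<Rightarrow> real" where
  "taboo_prob S P C D 0 x = (\<Sum>y\<in>S. if y \<in> D then P x y else 0)"
| "taboo_prob S P C D (Suc n) x = (\<Sum>z\<in>S. if z \<in> C then 0 else P x z * taboo_prob S P C D n z)"

text \<open>The path measure is known through its cylinders, so the induction on \<open>n\<close>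
  carries an arbitrary prefix \<open>w\<close> up to time \<open>k\<close>: splitting by the next
  state lengthens the prefix by one and shortens the taboo period by one.\<close>

lemma measure_cylinder_taboo:
  assumes S: "finite S" "stochastic S P" "x \<in> S" and w: "\<And>i. i \<le> k \<Longrightarrow> w i \<in> S"
  shows "\<P>(\<omega> in path_measure S P x. (\<forall>i\<le>k. \<omega> i = w i) \<and>
      (\<forall>i\<in>{k<..k+n}. \<omega> i \<notin> C) \<and> \<omega> (Suc (k + n)) \<in> D) =
    (if w 0 = x then 1 else 0) * (\<Prod>i<k. P (w i) (w (Suc i))) * taboo_prob S P C D n (w k)"
  using w
proof (induction n arbitrary: k w)
  case 0
  let ?M = "path_measure S P x"
  note [measurable] = pred_path_coord[OF S]
  have *: "\<P>(\<omega> in ?M. \<omega> (Suc k) = z \<and> (\<forall>i\<le>k. \<omega> i = w i) \<and> \<omega> (Suc k) \<in> D) =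
     (if w 0 = x then 1 else 0) * (\<Prod>i<k. P (w i) (w (Suc i))) * (if z \<in> D then P (w k) z else 0)"
    if "z \<in> S" for z
  proof (cases "z \<in> D")
    case True
    have "\<P>(\<omega> in ?M. \<omega> (Suc k) = z \<and> (\<forall>i\<le>k. \<omega> i = w i) \<and> \<omega> (Suc k) \<in> D) =
        \<P>(\<omega> in ?M. \<forall>i\<le>Suc k. \<omega> i = (w(Suc k := z)) i)"
      using True by (intro arg_cong[where f = "measure ?M"]) (auto simp: le_Suc_eq)
    also have "\<dots> = (if w 0 = x then 1 else 0) * (\<Prod>i<k. P (w i) (w (Suc i))) * P (w k) z"
      using 0 that by (subst measure_path_cylinder[OF S]) (auto simp: le_Suc_eq)
    finally show ?thesis using True by simp
  next
    case False
    then have "{\<omega>\<in>space ?M. \<omega> (Suc k) = z \<and> (\<forall>i\<le>k. \<omega> i = w i) \<and> \<omega> (Suc k) \<in> D} = {}" by auto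
    then show ?thesis using False by (simp only:) simp
  qed
  have "\<P>(\<omega> in ?M. (\<forall>i\<le>k. \<omega> i = w i) \<and> \<omega> (Suc k) \<in> D) =
      (\<Sum>z\<in>S. \<P>(\<omega> in ?M. \<omega> (Suc k) = z \<and> (\<forall>i\<le>k. \<omega> i = w i) \<and> \<omega> (Suc k) \<in> D))"
    by (rule measure_path_split[OF S]) measurable
  also have "\<dots> = (if w 0 = x then 1 else 0) * (\<Prod>i<k. P (w i) (w (Suc i))) * taboo_prob S P C D 0 (w k)"
    unfolding taboo_prob.simps sum_distrib_left by (intro sum.cong refl *)
  finally show ?case by simp
next
  case (Suc n)
  let ?M = "path_measure S P x"
  note [measurable] = pred_path_coord[OF S]
  let ?Q = "\<lambda>\<omega>. (\<forall>i\<le>k. \<omega> i = w i) \<and> (\<forall>i\<in>{k<..k+Suc n}. \<omega> i \<notin> C) \<and> \<omega> (Suc (k + Suc n)) \<in> D"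
  have *: "\<P>(\<omega> in ?M. \<omega> (Suc k) = z \<and> ?Q \<omega>) =
     (if w 0 = x then 1 else 0) * (\<Prod>i<k. P (w i) (w (Suc i))) *
       (if z \<in> C then 0 else P (w k) z * taboo_prob S P C D n z)"
    if "z \<in> S" for z
  proof (cases "z \<in> C")
    case False
    have "{k<..k+Suc n} = insert (Suc k) {Suc k<..Suc k+n}" by auto
    then have "\<P>(\<omega> in ?M. \<omega> (Suc k) = z \<and> ?Q \<omega>) =
        \<P>(\<omega> in ?M. (\<forall>i\<le>Suc k. \<omega> i = (w(Suc k := z)) i) \<and> (\<forall>i\<in>{Suc k<..Suc k+n}. \<omega> i \<notin> C) \<and>
          \<omega> (Suc (Suc k + n)) \<in> D)"
      using False by (intro arg_cong[where f = "measure ?M"]) (auto simp: le_Suc_eq)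
    also have "\<dots> = (if w 0 = x then 1 else 0) * (\<Prod>i<k. P (w i) (w (Suc i))) *
         (P (w k) z * taboo_prob S P C D n z)"
      using Suc.prems that by (subst Suc.IH) (auto simp: le_Suc_eq)
    finally show ?thesis using False by simp
  next
    case True
    then have "{\<omega>\<in>space ?M. \<omega> (Suc k) = z \<and> ?Q \<omega>} = {}" by fastforce
    then show ?thesis using True by (simp only:) simp
  qed
  have "\<P>(\<omega> in ?M. ?Q \<omega>) = (\<Sum>z\<in>S. \<P>(\<omega> in ?M. \<omega> (Suc k) = z \<and> ?Q \<omega>))"
    by (rule measure_path_split[OF S]) measurable
  also have "\<dots> = (if w 0 = x then 1 else 0) * (\<Prod>i<k. P (w i) (w (Suc i))) *
      taboo_prob S P C D (Suc n) (w k)"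
    unfolding taboo_prob.simps sum_distrib_left by (intro sum.cong refl *)
  finally show ?case .
qed

lemma measure_taboo:
  assumes S: "finite S" "stochastic S P" "x \<in> S"
  shows "\<P>(\<omega> in path_measure S P x. (\<forall>m<n. \<omega> (Suc m) \<notin> C) \<and> \<omega> (Suc n) \<in> D) = taboo_prob S P C D n x"
proof -
  let ?M = "path_measure S P x"
  interpret prob_space ?M by (rule prob_space_path_measure[OF S])
  note [measurable] = pred_path_coord[OF S]
  \<comment> \<open>The coordinate at time 0 equals \<open>x\<close> only almost surely, so the two
    events below are compared outside a null set.\<close>
  have "prob {\<omega>\<in>space ?M. \<omega> 0 = x} = 1"
    using measure_path_cylinder[OF S, of 0 "\<lambda>_. x"] S(3) by simp
  then have AE: "AE \<omega> in ?M. \<omega> 0 = x"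
    by (subst (asm) prob_Collect_eq_1) simp_all
  have shift: "(\<forall>i\<in>{0<..n}. \<omega> i \<notin> C) \<longleftrightarrow> (\<forall>m<n. \<omega> (Suc m) \<notin> C)" for \<omega> :: "nat \<Rightarrow> 'a"
  proof -
    have "{0<..n} = Suc ` {..<n}"
      by (simp add: image_Suc_lessThan flip: atLeastSucAtMost_greaterThanAtMost)
    then show ?thesis by (auto simp: Ball_def)
  qed
  have "\<P>(\<omega> in ?M. (\<forall>m<n. \<omega> (Suc m) \<notin> C) \<and> \<omega> (Suc n) \<in> D) =
      \<P>(\<omega> in ?M. (\<forall>i\<le>0. \<omega> i = x) \<and> (\<forall>i\<in>{0<..0+n}. \<omega> i \<notin> C) \<and> \<omega> (Suc (0 + n)) \<in> D)"
  proof (rule measure_eq_AE)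
    show "AE \<omega> in ?M. (\<omega> \<in> {\<omega>\<in>space ?M. (\<forall>m<n. \<omega> (Suc m) \<notin> C) \<and> \<omega> (Suc n) \<in> D}) =
       (\<omega> \<in> {\<omega>\<in>space ?M. (\<forall>i\<le>0. \<omega> i = x) \<and> (\<forall>i\<in>{0<..0+n}. \<omega> i \<notin> C) \<and> \<omega> (Suc (0 + n)) \<in> D})"
      using AE by eventually_elim (simp add: shift)
  qed measurable
  then show ?thesis
    using S(3) by (subst (asm) measure_cylinder_taboo[OF S]) auto
qed

text \<open>For \<open>D \<subseteq> C\<close>, the only case of interest, this is the probability that \<open>X\<^bsub>\<tau>\<^esub> \<in> D\<close>, where \<open>\<tau>\<close> is the positive
  hitting time of \<open>C\<close>.\<close>
definition entry_prob ::
  "'a set \<Rightarrow> ('a \<Rightarrow> 'a \<Rightarrow> real) \<Rightarrow> 'a set \<Rightarrow> 'a set \<Rightarrow> 'a \<Rightarrow> real" where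
  "entry_prob S P C D x =
     \<P>(\<omega> in path_measure S P x. \<exists>n. (\<forall>m<n. \<omega> (Suc m) \<notin> C) \<and> \<omega> (Suc n) \<in> D)"

text \<open>Since \<open>D \<subseteq> C\<close>, an entry into \<open>D\<close> at time
  \<open>Suc n\<close> breaks the taboo for every later time. The events for different
  \<open>n\<close> are therefore disjoint and their probabilities add up.\<close>

lemma taboo_sums_entry_prob:
  assumes S: "finite S" "stochastic S P" "x \<in> S" and "D \<subseteq> C"
  shows "(\<lambda>n. taboo_prob S P C D n x) sums entry_prob S P C D x"
proof -
  let ?M = "path_measure S P x"
  interpret prob_space ?M by (rule prob_space_path_measure[OF S])
  note [measurable] = pred_path_coord[OF S]
  let ?A = "\<lambda>n. {\<omega>\<in>space ?M. (\<forall>m<n. \<omega> (Suc m) \<notin> C) \<and> \<omega> (Suc n) \<in> D}"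
  have "disjoint_family ?A"
    unfolding disjoint_family_on_def
  proof (intro ballI impI, rule ccontr)
    fix m n :: nat assume "m \<noteq> n" "?A m \<inter> ?A n \<noteq> {}"
    then obtain \<omega> where "\<omega> \<in> ?A m" "\<omega> \<in> ?A n" by blast
    then have "\<not> m < n" "\<not> n < m" using \<open>D \<subseteq> C\<close> by blast+
    then show False using \<open>m \<noteq> n\<close> by simp
  qed
  then have "(\<lambda>n. prob (?A n)) sums prob (\<Union>n. ?A n)"
    by (intro finite_measure_UNION) auto
  moreover have "(\<Union>n. ?A n) = {\<omega>\<in>space ?M. \<exists>n. (\<forall>m<n. \<omega> (Suc m) \<notin> C) \<and> \<omega> (Suc n) \<in> D}"
    by auto
  ultimately show ?thesis
    by (simp add: entry_prob_def measure_taboo[OF S])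
qed

lemma entry_prob_nonneg: "0 \<le> entry_prob S P C D x"
  by (simp add: entry_prob_def)

lemma entry_prob_le_1:
  assumes "finite S" "stochastic S P" "x \<in> S"
  shows "entry_prob S P C D x \<le> 1"
  unfolding entry_prob_def by (rule prob_space.prob_le_1[OF prob_space_path_measure[OF assms]])

text \<open>First-step analysis, read off the series: the term with index 0 is a direct jump into
  \<open>D\<close>, and the shifted series continues from a first state outside \<open>C\<close>. A
  first state in \<open>C - D\<close> contributes 0.\<close>

lemma entry_prob_step:
  assumes S: "finite S" "stochastic S P" "x \<in> S" and "D \<subseteq> C"
  shows "entry_prob S P C D x =
    (\<Sum>y\<in>S. P x y * (if y \<in> C then (if y \<in> D then 1 else 0) else entry_prob S P C D y))"
proof -
  have "(\<lambda>n. taboo_prob S P C D (Suc n) x) sums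
      (\<Sum>z\<in>S. if z \<in> C then 0 else P x z * entry_prob S P C D z)"
    unfolding taboo_prob.simps
    using taboo_sums_entry_prob[OF S(1,2) _ \<open>D \<subseteq> C\<close>]
    by (intro sums_sum) (auto intro: sums_mult)
  then have "(\<lambda>n. taboo_prob S P C D n x) sums
      ((\<Sum>z\<in>S. if z \<in> C then 0 else P x z * entry_prob S P C D z) + taboo_prob S P C D 0 x)"
    by (rule sums_Suc)
  then have "entry_prob S P C D x =
      (\<Sum>z\<in>S. if z \<in> C then 0 else P x z * entry_prob S P C D z) + taboo_prob S P C D 0 x"
    using sums_unique2[OF taboo_sums_entry_prob[OF assms]] by blast
  also have "\<dots> = (\<Sum>y\<in>S. P x y * (if y \<in> C then (if y \<in> D then 1 else 0) else entry_prob S P C D y))"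
    unfolding taboo_prob.simps sum.distrib[symmetric] using \<open>D \<subseteq> C\<close> by (intro sum.cong) auto
  finally show ?thesis .
qed

section \<open>Hitting times expressed through entry events\<close>

lemma hit_pos_le_iff: "hit_pos A \<omega> \<le> enat n \<longleftrightarrow> (\<exists>m<n. \<omega> (Suc m) \<in> A)"
proof
  let ?I = "{enat n | n. 0 < n \<and> \<omega> n \<in> A}"
  assume le: "hit_pos A \<omega> \<le> enat n"
  have "?I \<noteq> {}"
  proof
    assume "?I = {}"
    then have "hit_pos A \<omega> = \<infinity>"
      unfolding hit_pos_def by (simp only: Inf_enat_def refl if_True)
    then show False using le by simp
  qed
  then have "\<exists>t. t \<in> ?I" by blast
  \<comment> \<open>The infimum of a nonempty set in \<open>enat\<close> is its least element, hence
    attained.\<close>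
  then have "(LEAST t. t \<in> ?I) \<in> ?I" by (rule LeastI_ex)
  then have "Inf ?I \<in> ?I"
    using \<open>?I \<noteq> {}\<close> by (simp only: Inf_enat_def if_False)
  then obtain m where "0 < m" "\<omega> m \<in> A" "hit_pos A \<omega> = enat m"
    by (auto simp: hit_pos_def)
  then show "\<exists>m<n. \<omega> (Suc m) \<in> A"
    using le by (intro exI[of _ "m - 1"]) auto
next
  assume "\<exists>m<n. \<omega> (Suc m) \<in> A"
  then obtain m where "m < n" "\<omega> (Suc m) \<in> A" by blast
  then have "hit_pos A \<omega> \<le> enat (Suc m)"
    unfolding hit_pos_def by (intro Inf_lower) auto
  also have "\<dots> \<le> enat n" using \<open>m < n\<close> by simp
  finally show "hit_pos A \<omega> \<le> enat n" .
qed

lemma hit_pos_eq_Suc_iff: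
  "hit_pos A \<omega> = enat (Suc n) \<longleftrightarrow> (\<forall>m<n. \<omega> (Suc m) \<notin> A) \<and> \<omega> (Suc n) \<in> A"
proof -
  have "hit_pos A \<omega> = enat (Suc n) \<longleftrightarrow> hit_pos A \<omega> \<le> enat (Suc n) \<and> \<not> hit_pos A \<omega> \<le> enat n"
    by (cases "hit_pos A \<omega>") auto
  also have "\<dots> \<longleftrightarrow> (\<forall>m<n. \<omega> (Suc m) \<notin> A) \<and> \<omega> (Suc n) \<in> A"
    unfolding hit_pos_le_iff by (auto simp: less_Suc_eq)
  finally show ?thesis .
qed

lemma hit_pos_finite: "hit_pos A \<omega> < \<infinity> \<longleftrightarrow> (\<exists>n. hit_pos A \<omega> = enat (Suc n))"
proof (cases "hit_pos A \<omega>")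
  case (enat n)
  moreover have "\<not> hit_pos A \<omega> \<le> enat 0" unfolding hit_pos_le_iff by simp
  ultimately show ?thesis by (cases n) auto
qed simp

lemma hit_prob_eq_entry_prob:
  assumes "y \<in> A"
  shows "hit_prob S P x A y = entry_prob S P A {y} x"
proof -
  have "hit_pos A \<omega> < \<infinity> \<and> \<omega> (the_enat (hit_pos A \<omega>)) = y \<longleftrightarrow>
      (\<exists>n. (\<forall>m<n. \<omega> (Suc m) \<notin> A) \<and> \<omega> (Suc n) \<in> {y})" for \<omega>
  proof -
    have "hit_pos A \<omega> < \<infinity> \<and> \<omega> (the_enat (hit_pos A \<omega>)) = y \<longleftrightarrow>
        (\<exists>n. hit_pos A \<omega> = enat (Suc n) \<and> \<omega> (Suc n) = y)"
      unfolding hit_pos_finite by auto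
    also have "\<dots> \<longleftrightarrow> (\<exists>n. (\<forall>m<n. \<omega> (Suc m) \<notin> A) \<and> \<omega> (Suc n) \<in> {y})"
      unfolding hit_pos_eq_Suc_iff using assms by auto
    finally show ?thesis .
  qed
  then show ?thesis
    unfolding hit_prob_def entry_prob_def by simp
qed

text \<open>Disjointness of \<open>A\<close> and \<open>B\<close> rules out a tie, so the first
  visit to \<open>A \<union> B\<close> at a positive time decides the order. A path that never
  visits \<open>B\<close> is covered, its hitting time of \<open>B\<close> being
  \<infinity>.\<close>

lemma hit_before_prob_eq_entry_prob:
  assumes "A \<inter> B = {}"
  shows "hit_before_prob S P x A B = entry_prob S P (A \<union> B) A x"
proof -
  have "hit_pos A \<omega> < hit_pos B \<omega> \<longleftrightarrow>
      (\<exists>n. (\<forall>m<n. \<omega> (Suc m) \<notin> A \<union> B) \<and> \<omega> (Suc n) \<in> A)" for \<omega>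
  proof -
    have "hit_pos A \<omega> < hit_pos B \<omega> \<longleftrightarrow> (\<exists>n. hit_pos A \<omega> = enat (Suc n) \<and> \<not> hit_pos B \<omega> \<le> enat (Suc n))"
      using hit_pos_finite[of A \<omega>] by (cases "hit_pos A \<omega>") (auto simp: not_le)
    also have "\<dots> \<longleftrightarrow> (\<exists>n. (\<forall>m<n. \<omega> (Suc m) \<notin> A \<union> B) \<and> \<omega> (Suc n) \<in> A)"
      unfolding hit_pos_eq_Suc_iff hit_pos_le_iff using assms by (auto simp: less_Suc_eq)
    finally show ?thesis .
  qed
  then show ?thesis
    unfolding hit_before_prob_def entry_prob_def by simp
qed

section \<open>Compactness along filters\<close>

text \<open>Replaces the extraction of convergent subsequences. One coordinate is treated at a time:
  compactness of \<open>{0..1}\<close> yields a cluster point \<open>l\<close>, and refining the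
  filter by the preimages of the neighbourhoods of \<open>l\<close> forces convergence.\<close>

lemma convergent_subfilter:
  fixes m :: "'b \<Rightarrow> 'a \<Rightarrow> real"
  assumes "finite S" "F \<noteq> bot" "\<And>x. x \<in> S \<Longrightarrow> eventually (\<lambda>t. m t x \<in> {0..1}) F"
  shows "\<exists>G c. G \<le> F \<and> G \<noteq> bot \<and> (\<forall>x\<in>S. ((\<lambda>t. m t x) \<longlongrightarrow> c x) G)"
  using assms(1,3)
proof (induction S)
  case empty
  then show ?case using assms(2) by auto
next
  case (insert a S)
  then obtain G c where G: "G \<le> F" "G \<noteq> bot" "\<And>x. x \<in> S \<Longrightarrow> ((\<lambda>t. m t x) \<longlongrightarrow> c x) G"
    by auto
  let ?f = "\<lambda>t. m t a"
  have "filtermap ?f G \<noteq> bot" using G(2) by (simp add: filtermap_bot_iff)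
  moreover have "eventually (\<lambda>s. s \<in> {0..1}) (filtermap ?f G)"
    using insert.prems[of a] G(1) by (auto simp: eventually_filtermap le_filter_def)
  ultimately obtain l where l: "inf (nhds l) (filtermap ?f G) \<noteq> bot"
    using compact_Icc[of 0 "1::real"] unfolding compact_filter by blast
  define G' where "G' = inf (filtercomap ?f (nhds l)) G"
  \<comment> \<open>Otherwise some neighbourhood of \<open>l\<close> would be avoided eventually
    along \<open>G\<close>, although \<open>l\<close> is a cluster point.\<close>
  have "G' \<noteq> bot"
  proof
    assume "G' = bot"
    then have "eventually (\<lambda>_. False) G'" by simp
    then obtain Q Q' where Q: "eventually Q (filtercomap ?f (nhds l))" "eventually Q' G"
      "\<And>t. Q t \<Longrightarrow> Q' t \<Longrightarrow> False"
      unfolding G'_def eventually_inf by blast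
    then obtain R where R: "eventually R (nhds l)" "\<And>t. R (?f t) \<Longrightarrow> Q t"
      unfolding eventually_filtercomap by blast
    have "eventually (\<lambda>s. \<not> R s) (filtermap ?f G)"
      unfolding eventually_filtermap using Q(2) by eventually_elim (use Q(3) R(2) in blast)
    with R(1) have "eventually (\<lambda>_. False) (inf (nhds l) (filtermap ?f G))"
      unfolding eventually_inf by blast
    with l show False by (simp add: trivial_limit_def)
  qed
  moreover have "G' \<le> G" "G' \<le> F"
    using G(1) by (auto simp: G'_def le_infI2)
  moreover have "(?f \<longlongrightarrow> l) G'"
    unfolding filterlim_iff_le_filtercomap G'_def by simp
  moreover have "((\<lambda>t. m t x) \<longlongrightarrow> c x) G'" if "x \<in> S" for x
    using G(3)[OF that] \<open>G' \<le> G\<close> by (rule tendsto_mono[rotated])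
  ultimately show ?case
    using insert.hyps by (intro exI[of _ G'] exI[of _ "c(a := l)"]) auto
qed

text \<open>For limits determined by equations with a unique solution: it suffices to identify
  \<open>c z\<close> for simultaneous limits \<open>c\<close> of all coordinates along finer
  filters. If convergence to \<open>L\<close> failed, restricting \<open>F\<close> to the set where
  \<open>m t z\<close> stays outside some neighbourhood of \<open>L\<close> would produce a
  \<open>c\<close> with \<open>c z \<noteq> L\<close>.\<close>

lemma tendsto_by_subfilters:
  fixes m :: "'b \<Rightarrow> 'a \<Rightarrow> real"
  assumes S: "finite S" "z \<in> S" and bound: "\<And>x. x \<in> S \<Longrightarrow> eventually (\<lambda>t. m t x \<in> {0..1}) F"
    and lim: "\<And>G c. G \<le> F \<Longrightarrow> G \<noteq> bot \<Longrightarrow> (\<And>x. x \<in> S \<Longrightarrow> ((\<lambda>t. m t x) \<longlongrightarrow> c x) G) \<Longrightarrow> c z = L"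
  shows "((\<lambda>t. m t z) \<longlongrightarrow> L) F"
proof (rule topological_tendstoI, rule ccontr)
  fix U assume U: "open U" "L \<in> U" "\<not> eventually (\<lambda>t. m t z \<in> U) F"
  define F' where "F' = inf F (principal {t. m t z \<notin> U})"
  have "F' \<noteq> bot"
    using U(3) unfolding F'_def trivial_limit_def eventually_inf_principal by simp
  moreover have "F' \<le> F" by (simp add: F'_def)
  ultimately obtain G c where G: "G \<le> F'" "G \<noteq> bot" "\<And>x. x \<in> S \<Longrightarrow> ((\<lambda>t. m t x) \<longlongrightarrow> c x) G"
    using convergent_subfilter[OF S(1), of F' m] bound unfolding le_filter_def by metis
  have "c z = L"
    using G \<open>F' \<le> F\<close> by (intro lim) auto
  then have "eventually (\<lambda>t. m t z \<in> U) G"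
    using G(3)[OF S(2)] U(1,2) by (auto dest: topological_tendstoD)
  moreover have "eventually (\<lambda>t. m t z \<notin> U) G"
    using G(1) by (auto simp: F'_def le_filter_def eventually_inf_principal)
  ultimately have "eventually (\<lambda>_. False) G" by eventually_elim simp
  with G(2) show False by (simp add: trivial_limit_def)
qed

section \<open>Finite chains\<close>

text \<open>Closed sets of the chain, phrased through single transitions to keep powers of
  \<open>P\<close> out of the later arguments. The empty set qualifies, hence the side condition
  \<open>T \<noteq> {}\<close> where such sets are used.\<close>

definition absorbing :: "'a set \<Rightarrow> ('a \<Rightarrow> 'a \<Rightarrow> real) \<Rightarrow> 'a set \<Rightarrow> bool" where
  "absorbing S P T \<longleftrightarrow> T \<subseteq> S \<and> (\<forall>x\<in>T. \<forall>y\<in>S - T. P x y = 0)"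

locale finite_chain =
  fixes S :: "'a set" and P :: "'a \<Rightarrow> 'a \<Rightarrow> real"
  assumes finite_S [simp]: "finite S" and stochastic: "stochastic S P"
begin

lemma nonneg: "x \<in> S \<Longrightarrow> y \<in> S \<Longrightarrow> 0 \<le> P x y"
  and row_sum: "x \<in> S \<Longrightarrow> (\<Sum>y\<in>S. P x y) = 1"
  using stochastic by (auto simp: stochastic_def)

lemma n_step_nonneg: "x \<in> S \<Longrightarrow> 0 \<le> n_step S P n x y"
  by (induction n arbitrary: x) (auto intro!: sum_nonneg mult_nonneg_nonneg nonneg)

lemma n_step_sum: "x \<in> S \<Longrightarrow> (\<Sum>y\<in>S. n_step S P n x y) = 1"
proof (induction n arbitrary: x)
  case (Suc n)
  have "(\<Sum>y\<in>S. n_step S P (Suc n) x y) = (\<Sum>z\<in>S. P x z * (\<Sum>y\<in>S. n_step S P n z y))"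
    unfolding n_step.simps sum_distrib_left by (rule sum.swap)
  then show ?case using Suc row_sum by simp
qed simp

lemma n_step_Suc_right:
  assumes "x \<in> S" "y \<in> S"
  shows "n_step S P (Suc n) x y = (\<Sum>z\<in>S. n_step S P n x z * P z y)"
  using assms
proof (induction n arbitrary: x)
  case 0
  then show ?case
    by (simp add: if_distrib[where f = "\<lambda>a. _ * a"] if_distrib[where f = "\<lambda>a. a * _"] cong: if_cong)
next
  case (Suc n)
  have "n_step S P (Suc (Suc n)) x y = (\<Sum>w\<in>S. P x w * (\<Sum>z\<in>S. n_step S P n w z * P z y))"
    unfolding n_step.simps(2)[of S P "Suc n"] using Suc by (intro sum.cong) auto
  also have "\<dots> = (\<Sum>z\<in>S. n_step S P (Suc n) x z * P z y)"
    unfolding n_step.simps sum_distrib_left sum_distrib_right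
    by (subst sum.swap) (simp add: mult.assoc)
  finally show ?case .
qed

section \<open>Absorbing sets and essential classes\<close>

lemma leads_to_in_absorbing:
  assumes "absorbing S P T" "x \<in> T" "y \<in> S" "leads_to S P x y"
  shows "y \<in> T"
proof (rule ccontr)
  assume "y \<notin> T"
  have "n_step S P n w y = 0" if "w \<in> T" for n w
    using that
  proof (induction n arbitrary: w)
    case (Suc n)
    have "P w z * n_step S P n z y = 0" if "z \<in> S" for z
      using Suc assms(1) that by (cases "z \<in> T") (auto simp: absorbing_def)
    then show ?case unfolding n_step.simps by (intro sum.neutral) blast
  qed (use \<open>y \<notin> T\<close> in auto)
  then show False using assms by (auto simp: leads_to_def)
qed

lemma leads_to_refl: "leads_to S P x x"
  unfolding leads_to_def by (rule exI[of _ 0]) simp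

lemma leads_to_step:
  assumes "x \<in> S" "z \<in> S" "y \<in> S" "leads_to S P x z" "P z y \<noteq> 0"
  shows "leads_to S P x y"
proof -
  obtain n where "0 < n_step S P n x z" using assms by (auto simp: leads_to_def)
  then have "0 < n_step S P n x z * P z y"
    using assms nonneg[of z y] by (intro mult_pos_pos) auto
  also have "\<dots> \<le> (\<Sum>z\<in>S. n_step S P n x z * P z y)"
    using assms by (intro member_le_sum) (auto intro!: mult_nonneg_nonneg n_step_nonneg nonneg)
  also have "\<dots> = n_step S P (Suc n) x y"
    using assms by (simp only: n_step_Suc_right)
  finally show ?thesis unfolding leads_to_def by blast
qed

lemma absorbing_reachable: "x \<in> S \<Longrightarrow> absorbing S P {y \<in> S. leads_to S P x y}"
  unfolding absorbing_def using leads_to_step by blast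

lemma absorbing_essential_class:
  assumes "E \<in> essential_classes S P"
  shows "absorbing S P E"
  unfolding absorbing_def
proof (intro conjI ballI)
  show "E \<subseteq> S" using assms by (auto simp: essential_classes_def comm_class_def)
  fix x y assume "x \<in> E" "y \<in> S - E"
  moreover from this have "x \<in> S" using \<open>E \<subseteq> S\<close> by auto
  ultimately show "P x y = 0"
    using leads_to_step[of x x y] leads_to_refl[of x] assms by (auto simp: essential_classes_def)
qed

lemma essential_class_eq_reachable:
  assumes "E \<in> essential_classes S P" "x \<in> E"
  shows "E = {y \<in> S. leads_to S P x y}"
proof -
  obtain a where a: "a \<in> S" "E = {y \<in> S. leads_to S P a y \<and> leads_to S P y a}"
    using assms by (auto simp: essential_classes_def comm_class_def)
  have x: "x \<in> S" "leads_to S P x a" using assms a by auto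
  have "E \<subseteq> {y \<in> S. leads_to S P x y}"
  proof
    fix y assume "y \<in> E"
    then show "y \<in> {y \<in> S. leads_to S P x y}"
      using leads_to_in_absorbing[OF absorbing_reachable[OF x(1)], of a y] a x by auto
  qed
  then show ?thesis using assms by (auto simp: essential_classes_def)
qed

lemma comm_class_essential:
  assumes "E \<in> essential_classes S P" "x \<in> E"
  shows "comm_class S P x = E"
proof -
  have "leads_to S P y x" if "y \<in> E" for y
    using essential_class_eq_reachable[OF assms(1) that] assms(2) by auto
  then show ?thesis
    using essential_class_eq_reachable[OF assms] unfolding comm_class_def by auto
qed

lemma essential_class_nonempty:
  assumes "E \<in> essential_classes S P" shows "E \<noteq> {}"
  using assms leads_to_refl by (auto simp: essential_classes_def comm_class_def)

text \<open>Choose a state of \<open>T\<close> whose reachable set has least cardinality. Every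
  state reached from it has the same reachable set, so the two communicate and this set is an
  essential class.\<close>

lemma absorbing_contains_essential:
  assumes T: "absorbing S P T" "T \<noteq> {}"
  shows "\<exists>E\<in>essential_classes S P. E \<subseteq> T"
proof -
  define R where "R x = {y \<in> S. leads_to S P x y}" for x
  have TS: "T \<subseteq> S" using T by (simp add: absorbing_def)
  obtain x where x: "x \<in> T" "\<And>y. y \<in> T \<Longrightarrow> card (R x) \<le> card (R y)"
    using ex_has_least_nat[of "\<lambda>x. x \<in> T" _ "\<lambda>x. card (R x)"] T(2) by blast
  have RT: "R x \<subseteq> T"
    using leads_to_in_absorbing[OF T(1) x(1)] by (auto simp: R_def)
  have R_eq: "R y = R x" if "y \<in> R x" for y
  proof (rule card_seteq)
    show "R y \<subseteq> R x"
      using leads_to_in_absorbing[OF absorbing_reachable[of x], of y] that x(1) TS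
      by (auto simp: R_def)
    show "card (R x) \<le> card (R y)" using that RT x(2) by auto
  qed (simp add: R_def)
  have "x \<in> R x" using x TS leads_to_refl by (auto simp: R_def)
  have "R x = comm_class S P x"
  proof -
    have "leads_to S P y x" if "y \<in> R x" for y
    proof -
      have "x \<in> R y" using R_eq[OF that] \<open>x \<in> R x\<close> by simp
      then show ?thesis by (simp add: R_def)
    qed
    then show ?thesis unfolding comm_class_def R_def by blast
  qed
  moreover have "z \<in> R x" if "y \<in> R x" "z \<in> S" "leads_to S P y z" for y z
    using R_eq[OF that(1)] that by (auto simp: R_def)
  ultimately have "R x \<in> essential_classes S P"
    using x TS unfolding essential_classes_def by auto
  then show ?thesis using RT by blast
qed

text \<open>The step from essential classes to irreducible chains. As \<open>E\<close> is absorbing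
  in \<open>S\<close>, a set absorbing for the chain restricted to \<open>E\<close> is absorbing in
  \<open>S\<close> as well, and from any of its points all of \<open>E\<close> is reached.\<close>

lemma essential_class_minimal:
  assumes "E \<in> essential_classes S P" "absorbing E P T" "T \<noteq> {}"
  shows "T = E"
proof -
  have E: "absorbing S P E" by (rule absorbing_essential_class[OF assms(1)])
  then have T: "absorbing S P T" using assms(2) unfolding absorbing_def by blast
  obtain x where "x \<in> T" using assms(3) by blast
  then have "E \<subseteq> T"
    using leads_to_in_absorbing[OF T] essential_class_eq_reachable[OF assms(1), of x] assms(2)
    by (auto simp: absorbing_def)
  then show ?thesis using assms(2) by (auto simp: absorbing_def)
qed

lemma essential_class_chain: "E \<in> essential_classes S P \<Longrightarrow> finite_chain E P"
proof
  assume "E \<in> essential_classes S P"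
  then have E: "absorbing S P E" by (rule absorbing_essential_class)
  then show "finite E" by (auto simp: absorbing_def intro: finite_subset)
  have "(\<Sum>y\<in>E. P x y) = 1" if "x \<in> E" for x
  proof -
    have "(\<Sum>y\<in>E. P x y) = (\<Sum>y\<in>S. P x y)"
      using E that by (intro sum.mono_neutral_left) (auto simp: absorbing_def)
    then show ?thesis using E that row_sum by (auto simp: absorbing_def)
  qed
  then show "stochastic E P" using E nonneg by (auto simp: stochastic_def absorbing_def)
qed

lemma essential_classes_disjoint:
  assumes "E \<in> essential_classes S P" "E' \<in> essential_classes S P" "E \<noteq> E'"
  shows "E \<inter> E' = {}"
  using essential_class_eq_reachable assms by blast

text \<open>Summing invariance over the union \<open>U\<close> of the essential classes shows that
  no mass flows into \<open>U\<close> from outside. The part of the support outside \<open>U\<close>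
  is then absorbing, and if nonempty it would contain an essential class.\<close>

lemma stationary_mass_transient:
  assumes \<mu>: "stationary S P \<mu>" and x: "x \<in> S" "x \<notin> \<Union>(essential_classes S P)"
  shows "\<mu> x = 0"
proof (rule ccontr)
  assume "\<mu> x \<noteq> 0"
  define U where "U = \<Union>(essential_classes S P)"
  define T where "T = {y \<in> S - U. \<mu> y \<noteq> 0}"
  have \<mu>_nonneg: "0 \<le> \<mu> y" if "y \<in> S" for y using \<mu> that by (auto simp: stationary_def)
  have \<mu>_eq: "(\<Sum>x\<in>S. \<mu> x * P x y) = \<mu> y" if "y \<in> S" for y using \<mu> that by (auto simp: stationary_def)
  have US: "U \<subseteq> S" using absorbing_essential_class by (auto simp: U_def absorbing_def)
  then have finU: "finite U" by (rule finite_subset) simp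
  have UP: "(\<Sum>y\<in>U. P z y) = 1" if "z \<in> U" for z
  proof -
    have "(\<Sum>y\<in>U. P z y) = (\<Sum>y\<in>S. P z y)"
      using that US absorbing_essential_class by (intro sum.mono_neutral_left) (auto simp: absorbing_def U_def)
    then show ?thesis using that US row_sum by auto
  qed
  have "(\<Sum>y\<in>U. \<mu> y) = (\<Sum>z\<in>S. \<mu> z * (\<Sum>y\<in>U. P z y))"
    unfolding sum_distrib_left using US by (subst sum.swap) (auto intro!: sum.cong simp: \<mu>_eq)
  also have "\<dots> = (\<Sum>z\<in>U. \<mu> z * (\<Sum>y\<in>U. P z y)) + (\<Sum>z\<in>S - U. \<mu> z * (\<Sum>y\<in>U. P z y))"
    using US by (subst sum.subset_diff[of U]) auto
  also have "(\<Sum>z\<in>U. \<mu> z * (\<Sum>y\<in>U. P z y)) = (\<Sum>y\<in>U. \<mu> y)"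
    using UP by simp
  finally have "(\<Sum>z\<in>S - U. \<mu> z * (\<Sum>y\<in>U. P z y)) = 0" by simp
  then have zero: "\<mu> z * (\<Sum>y\<in>U. P z y) = 0" if "z \<in> S - U" for z
    using that US
    by (subst (asm) sum_nonneg_eq_0_iff) (auto intro!: mult_nonneg_nonneg sum_nonneg \<mu>_nonneg nonneg)
  have "absorbing S P T"
    unfolding absorbing_def
  proof (intro conjI ballI)
    fix z y assume z: "z \<in> T" and y: "y \<in> S - T"
    show "P z y = 0"
    proof (cases "y \<in> U")
      case True
      have "(\<Sum>y\<in>U. P z y) = 0" using zero[of z] z by (auto simp: T_def)
      then show ?thesis
        using True z US by (subst (asm) sum_nonneg_eq_0_iff) (auto simp: finU T_def intro!: nonneg)
    next
      case False
      then have "\<mu> y = 0" using y by (auto simp: T_def)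
      then have "(\<Sum>x\<in>S. \<mu> x * P x y) = 0" using \<mu>_eq[of y] y by simp
      then have "\<mu> z * P z y = 0"
        using z y by (subst (asm) sum_nonneg_eq_0_iff)
          (auto intro!: mult_nonneg_nonneg \<mu>_nonneg nonneg simp: T_def)
      then show ?thesis using z by (auto simp: T_def)
    qed
  qed (auto simp: T_def)
  moreover have "x \<in> T" using x \<open>\<mu> x \<noteq> 0\<close> by (auto simp: T_def U_def)
  ultimately obtain E where "E \<in> essential_classes S P" "E \<subseteq> T"
    using absorbing_contains_essential by blast
  then show False using essential_class_nonempty[of E] by (auto simp: T_def U_def)
qed

text \<open>A limit point of the Cesaro means of the rows of \<open>P\<^sup>k\<close> is stationary.\<close>
lemma stationary_exists:
  assumes "S \<noteq> {}"
  shows "\<exists>\<mu>. stationary S P \<mu>"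
proof -
  obtain x where x: "x \<in> S" using assms by blast
  define m where "m K y = (\<Sum>k<Suc K. n_step S P k x y) / Suc K" for K y
  have nonneg_m: "0 \<le> m K y" for K y
    unfolding m_def using n_step_nonneg[OF x] by (intro divide_nonneg_nonneg sum_nonneg) auto
  have sum_m: "(\<Sum>y\<in>S. m K y) = 1" for K
  proof -
    have "(\<Sum>y\<in>S. m K y) = (\<Sum>k<Suc K. \<Sum>y\<in>S. n_step S P k x y) / Suc K"
      unfolding m_def sum_divide_distrib[symmetric] by (subst sum.swap) simp
    then show ?thesis by (simp add: n_step_sum[OF x] del: sum.lessThan_Suc)
  qed
  have m_le: "m K y \<le> 1" if "y \<in> S" for K y
    using member_le_sum[of y S "m K"] that nonneg_m sum_m by auto
  have "\<exists>G c. G \<le> sequentially \<and> G \<noteq> bot \<and> (\<forall>y\<in>S. ((\<lambda>K. m K y) \<longlongrightarrow> c y) G)"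
    by (rule convergent_subfilter) (auto simp: nonneg_m m_le)
  then obtain G c where G: "G \<le> sequentially" "G \<noteq> bot" "\<And>y. y \<in> S \<Longrightarrow> ((\<lambda>K. m K y) \<longlongrightarrow> c y) G"
    by blast
  \<comment> \<open>The sum telescopes, so the Cesaro means are invariant up to an error of order
    \<open>1 / Suc K\<close>.\<close>
  have step: "(\<Sum>z\<in>S. m K z * P z y) - m K y = (n_step S P (Suc K) x y - n_step S P 0 x y) / Suc K"
    if y: "y \<in> S" for K y
  proof -
    have "(\<Sum>z\<in>S. m K z * P z y) = (\<Sum>k<Suc K. n_step S P (Suc k) x y) / Suc K"
      unfolding m_def n_step_Suc_right[OF x y] times_divide_eq_left sum_divide_distrib[symmetric]
        sum_distrib_right by (subst sum.swap) simp
    then have "(\<Sum>z\<in>S. m K z * P z y) - m K y =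
        (\<Sum>k<Suc K. n_step S P (Suc k) x y - n_step S P k x y) / Suc K"
      by (simp only: m_def diff_divide_distrib sum_subtractf)
    then show ?thesis by (simp only: sum_lessThan_telescope[of "\<lambda>k. n_step S P k x y"])
  qed
  have "stationary S P c"
    unfolding stationary_def
  proof (intro conjI ballI)
    fix y assume y: "y \<in> S"
    show "0 \<le> c y"
      by (rule tendsto_lowerbound[OF G(3)[OF y] _ G(2)]) (simp add: nonneg_m)
    have n_le: "n_step S P k x y \<le> 1" for k
      using member_le_sum[of y S "n_step S P k x"] y n_step_nonneg[OF x] n_step_sum[OF x] by auto
    have "(\<lambda>K. (n_step S P (Suc K) x y - n_step S P 0 x y) / Suc K) \<longlonglongrightarrow> 0"
    proof (rule Lim_null_comparison)
      show "eventually (\<lambda>K. norm ((n_step S P (Suc K) x y - n_step S P 0 x y) / Suc K) \<le> 1 / real (Suc K))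
          sequentially"
      proof (intro always_eventually allI)
        fix K
        have "\<bar>n_step S P (Suc K) x y - n_step S P 0 x y\<bar> \<le> 1"
          using n_le[of 0] n_le[of "Suc K"] n_step_nonneg[OF x, of 0 y] n_step_nonneg[OF x, of "Suc K" y]
          by linarith
        then show "norm ((n_step S P (Suc K) x y - n_step S P 0 x y) / Suc K) \<le> 1 / real (Suc K)"
          by (simp only: real_norm_def abs_divide) (simp add: divide_right_mono del: n_step.simps)
      qed
    qed (use LIMSEQ_inverse_real_of_nat in \<open>simp add: inverse_eq_divide\<close>)
    then have "((\<lambda>K. (\<Sum>z\<in>S. m K z * P z y) - m K y) \<longlongrightarrow> 0) G"
      unfolding step[OF y] by (rule tendsto_mono[OF G(1)])
    moreover have "((\<lambda>K. (\<Sum>z\<in>S. m K z * P z y) - m K y) \<longlongrightarrow> (\<Sum>z\<in>S. c z * P z y) - c y) G"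
      by (intro tendsto_intros G(3) y)
    ultimately have "(\<Sum>z\<in>S. c z * P z y) - c y = 0"
      using G(2) tendsto_unique by blast
    then show "(\<Sum>z\<in>S. c z * P z y) = c y" by simp
  next
    have "((\<lambda>K. \<Sum>y\<in>S. m K y) \<longlongrightarrow> (\<Sum>y\<in>S. c y)) G"
      by (intro tendsto_sum G(3))
    then have "((\<lambda>K. 1) \<longlongrightarrow> (\<Sum>y\<in>S. c y)) G"
      by (simp only: sum_m)
    then show "(\<Sum>y\<in>S. c y) = 1"
      using G(2) by (simp add: tendsto_const_iff)
  qed
  then show ?thesis by blast
qed

section \<open>Entry probabilities of a finite chain and its trace on a subset\<close>

lemma entry_prob_bounds: "x \<in> S \<Longrightarrow> 0 \<le> entry_prob S P C D x \<and> entry_prob S P C D x \<le> 1"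
  by (intro conjI entry_prob_nonneg entry_prob_le_1[OF finite_S stochastic])

lemmas entry_step = entry_prob_step[OF finite_S stochastic]

text \<open>Integrating the first-step equation against \<open>\<mu>\<close> produces the same sum
  over \<open>S - C\<close> on both sides. What remains says that \<open>\<mu>\<close> restricted to
  \<open>C\<close> is invariant for the trace of the chain on \<open>C\<close>.\<close>

lemma trace_invariant:
  assumes \<mu>: "stationary S P \<mu>" and C: "C \<subseteq> S" "y \<in> C"
  shows "(\<Sum>x\<in>C. \<mu> x * entry_prob S P C {y} x) = \<mu> y"
proof -
  let ?w = "entry_prob S P C {y}"
  let ?g = "\<lambda>z. if z \<in> C then (if z \<in> {y} then 1 else 0) else ?w z"
  have finC: "finite C" using C(1) by (rule finite_subset) simp
  have "(\<Sum>x\<in>S. \<mu> x * ?w x) = (\<Sum>x\<in>S. \<Sum>z\<in>S. \<mu> x * P x z * ?g z)"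
    using C by (intro sum.cong refl) (subst entry_step, auto simp: sum_distrib_left mult.assoc)
  also have "\<dots> = (\<Sum>z\<in>S. (\<Sum>x\<in>S. \<mu> x * P x z) * ?g z)"
    unfolding sum_distrib_right by (rule sum.swap)
  also have "\<dots> = (\<Sum>z\<in>S. \<mu> z * ?g z)"
    using \<mu> by (intro sum.cong) (auto simp: stationary_def)
  finally have "(\<Sum>x\<in>C. \<mu> x * ?w x) + (\<Sum>x\<in>S - C. \<mu> x * ?w x) =
      (\<Sum>x\<in>C. \<mu> x * ?g x) + (\<Sum>x\<in>S - C. \<mu> x * ?g x)"
    using C(1) by (simp only: sum.subset_diff[of C S] finite_S add.commute)
  moreover have "(\<Sum>x\<in>S - C. \<mu> x * ?g x) = (\<Sum>x\<in>S - C. \<mu> x * ?w x)"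
    by (intro sum.cong) auto
  moreover have "(\<Sum>x\<in>C. \<mu> x * ?g x) = (\<Sum>x\<in>C. if x = y then \<mu> x else 0)"
    by (intro sum.cong) auto
  ultimately show ?thesis
    using C(2) finC by (simp add: sum.delta)
qed

end

text \<open>Irreducibility in the form in which it is used: a property holds everywhere once the
  states having it form a nonempty absorbing set.\<close>

locale irreducible_finite_chain = finite_chain +
  assumes nonempty: "S \<noteq> {}" and absorbing_eq: "absorbing S P T \<Longrightarrow> T \<noteq> {} \<Longrightarrow> T = S"
begin

text \<open>The support of \<open>f\<close> is absorbing: at a state \<open>y\<close> with
  \<open>f y = 0\<close>, invariance makes every nonnegative term \<open>f z * P z y\<close>
  vanish.\<close>

lemma invariant_pos:
  assumes f: "\<And>x. x \<in> S \<Longrightarrow> 0 \<le> f x" "\<And>y. y \<in> S \<Longrightarrow> (\<Sum>x\<in>S. f x * P x y) = f y"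
    and a: "a \<in> S" "f a \<noteq> 0" and x: "x \<in> S"
  shows "0 < f x"
proof -
  have "absorbing S P {x \<in> S. f x \<noteq> 0}"
    unfolding absorbing_def
  proof (intro conjI ballI)
    fix z y assume z: "z \<in> {x \<in> S. f x \<noteq> 0}" and y: "y \<in> S - {x \<in> S. f x \<noteq> 0}"
    then have "(\<Sum>x\<in>S. f x * P x y) = 0" using f(2)[of y] by auto
    then have "f z * P z y = 0"
      using z y by (subst (asm) sum_nonneg_eq_0_iff) (auto intro!: mult_nonneg_nonneg f nonneg)
    then show "P z y = 0" using z by simp
  qed auto
  then have "{x \<in> S. f x \<noteq> 0} = S" using a by (intro absorbing_eq) auto
  then show ?thesis using x f(1)[OF x] by force
qed

lemma stationary_pos:
  assumes "stationary S P \<mu>" "x \<in> S"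
  shows "0 < \<mu> x"
proof -
  obtain a where "a \<in> S" "\<mu> a \<noteq> 0"
    using assms by (metis stationary_def sum.neutral zero_neq_one)
  then show ?thesis using assms by (intro invariant_pos[of \<mu> a]) (auto simp: stationary_def)
qed

lemma stationary_unique:
  assumes \<mu>: "stationary S P \<mu>" and \<nu>: "stationary S P \<nu>" and x: "x \<in> S"
  shows "\<mu> x = \<nu> x"
proof -
  \<comment> \<open>\<open>r\<close> is the largest factor with \<open>r * \<nu> \<le> \<mu>\<close>
    on \<open>S\<close>. The difference \<open>f\<close> is nonnegative, invariant and zero at a
    minimiser, so it vanishes, and comparing total masses gives \<open>r = 1\<close>.\<close>
  define r where "r = Min ((\<lambda>x. \<mu> x / \<nu> x) ` S)"
  define f where "f y = \<mu> y - r * \<nu> y" for y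
  have "r \<in> (\<lambda>x. \<mu> x / \<nu> x) ` S" unfolding r_def using nonempty by (intro Min_in) auto
  then obtain a where a: "a \<in> S" "r = \<mu> a / \<nu> a" by blast
  have fa: "f a = 0" using a stationary_pos[OF \<nu> a(1)] by (simp add: f_def)
  have f_nonneg: "0 \<le> f y" if "y \<in> S" for y
  proof -
    have "r \<le> \<mu> y / \<nu> y" unfolding r_def using that by (intro Min_le) auto
    then show ?thesis using stationary_pos[OF \<nu> that] by (simp add: f_def pos_le_divide_eq)
  qed
  have f_inv: "(\<Sum>x\<in>S. f x * P x y) = f y" if "y \<in> S" for y
    using \<mu> \<nu> that
    by (simp add: f_def left_diff_distrib sum_subtractf mult.assoc sum_distrib_left[symmetric] stationary_def)
  have f0: "f y = 0" if "y \<in> S" for y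
  proof (rule ccontr)
    assume "f y \<noteq> 0"
    then have "0 < f a" using f_nonneg f_inv that a(1) by (intro invariant_pos[of f y])
    with fa show False by simp
  qed
  have "1 = (\<Sum>y\<in>S. r * \<nu> y)"
    using \<mu> f0 by (simp add: stationary_def f_def)
  also have "\<dots> = r" using \<nu> by (simp add: stationary_def sum_distrib_left[symmetric])
  finally show ?thesis using f0[OF x] by (simp add: f_def)
qed

lemma stat_dist_eq:
  assumes "stationary S P \<mu>" "x \<in> S"
  shows "stat_dist S P x = \<mu> x"
proof -
  \<comment> \<open>The definite description demands the value 0 outside \<open>S\<close>, so the
    witness is \<open>\<mu>\<close> cut off there.\<close>
  have "stat_dist S P = (\<lambda>x. if x \<in> S then \<mu> x else 0)"
    unfolding stat_dist_def
  proof (rule the_equality)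
    show "stationary S P (\<lambda>x. if x \<in> S then \<mu> x else 0) \<and> (\<forall>x. x \<notin> S \<longrightarrow> (if x \<in> S then \<mu> x else 0) = 0)"
      using assms by (simp add: stationary_def)
  next
    fix \<nu> assume "stationary S P \<nu> \<and> (\<forall>x. x \<notin> S \<longrightarrow> \<nu> x = 0)"
    then show "\<nu> = (\<lambda>x. if x \<in> S then \<mu> x else 0)"
      using stationary_unique[OF _ assms(1)] by auto
  qed
  then show ?thesis using assms by simp
qed

lemma stationary_stat_dist: "stationary S P (stat_dist S P)"
proof -
  obtain \<mu> where \<mu>: "stationary S P \<mu>" using stationary_exists[OF nonempty] by blast
  then show ?thesis by (simp add: stationary_def stat_dist_eq[OF \<mu>])
qed

lemma stat_dist_pos: "x \<in> S \<Longrightarrow> 0 < stat_dist S P x"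
  by (rule stationary_pos[OF stationary_stat_dist])

section \<open>Dirichlet problem and entry probabilities\<close>

text \<open>Maximum principle: the points where \<open>\<bar>f\<bar>\<close> is maximal would form an absorbing set.\<close>
lemma dirichlet_zero:
  assumes C: "C \<subseteq> S" "C \<noteq> {}" and x: "x \<in> S"
    and f: "\<And>z. z \<in> S \<Longrightarrow> f z = (\<Sum>y\<in>S. P z y * (if y \<in> C then 0 else f y))"
  shows "f x = 0"
proof -
  define M where "M = Max ((\<lambda>z. \<bar>f z\<bar>) ` S)"
  have le_M: "\<bar>f z\<bar> \<le> M" if "z \<in> S" for z
    unfolding M_def using that by (intro Max_ge) auto
  have "M = 0"
  proof (rule ccontr)
    assume "M \<noteq> 0"
    then have M: "M > 0" using le_M[OF x] by linarith
    define T where "T = {z \<in> S. \<bar>f z\<bar> = M}"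
    \<comment> \<open>A possible step from a maximum point into \<open>C\<close>, or to a state with
      smaller \<open>\<bar>f\<bar>\<close>, would make the average strictly smaller than
      \<open>M\<close>.\<close>
    have *: "y \<notin> C \<and> y \<in> T" if z: "z \<in> T" and y: "y \<in> S" and Pzy: "P z y \<noteq> 0" for z y
    proof (rule ccontr)
      assume neg: "\<not> (y \<notin> C \<and> y \<in> T)"
      have zS: "z \<in> S" using z by (simp add: T_def)
      let ?g = "\<lambda>y. if y \<in> C then 0 else f y"
      have "\<bar>?g y\<bar> \<noteq> M" using neg M y by (auto simp: T_def)
      then have lt: "\<bar>?g y\<bar> < M" using le_M[OF y] M by auto
      have "M = \<bar>\<Sum>y\<in>S. P z y * ?g y\<bar>" using z f[OF zS] by (simp add: T_def)
      also have "\<dots> \<le> (\<Sum>y\<in>S. \<bar>P z y * ?g y\<bar>)" by (rule sum_abs)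
      also have "\<dots> < (\<Sum>y\<in>S. P z y * M)"
      proof (rule sum_strict_mono_ex1)
        show "\<forall>y\<in>S. \<bar>P z y * ?g y\<bar> \<le> P z y * M"
          using nonneg[OF zS] le_M M by (auto simp: abs_mult intro!: mult_left_mono)
        have "\<bar>P z y * ?g y\<bar> < P z y * M"
          using nonneg[OF zS y] Pzy lt by (simp only: abs_mult) auto
        then show "\<exists>y\<in>S. \<bar>P z y * ?g y\<bar> < P z y * M" using y by blast
      qed simp
      also have "\<dots> = M" using row_sum[OF zS] by (simp add: sum_distrib_right[symmetric])
      finally show False by simp
    qed
    have "M \<in> (\<lambda>z. \<bar>f z\<bar>) ` S" unfolding M_def using nonempty by (intro Max_in) auto
    then have "T \<noteq> {}" by (auto simp: T_def)
    moreover have "absorbing S P T"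
      unfolding absorbing_def using * by (auto simp: T_def)
    ultimately have "T = S" by (intro absorbing_eq)
    \<comment> \<open>With \<open>T = S\<close>, the possible steps from every state avoid
      \<open>C\<close>, so \<open>S - C\<close> is absorbing too. It is nonempty because rows sum to
      1, hence it is all of \<open>S\<close>, contrary to \<open>C \<noteq> {}\<close>.\<close>
    then have "absorbing S P (S - C)"
      unfolding absorbing_def using * by blast
    moreover have "S - C \<noteq> {}"
    proof
      assume "S - C = {}"
      then have "(\<Sum>y\<in>S. P x y) = 0"
        using * x \<open>T = S\<close> by (intro sum.neutral) blast
      then show False using row_sum[OF x] by simp
    qed
    ultimately have "S - C = S" by (rule absorbing_eq)
    then show False using C by blast
  qed
  then show ?thesis using le_M[OF x] by simp
qed

text \<open>Both sides solve the same first-step equations, so their difference is zero by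
  \<open>dirichlet_zero\<close>. The data \<open>g\<close> are collected on arrival in
  \<open>C\<close>; for a starting point in \<open>C\<close> the value of \<open>u\<close> is again
  an average over the next step.\<close>

lemma dirichlet_entry_prob:
  assumes C: "C \<subseteq> S" "C \<noteq> {}" and x: "x \<in> S"
    and u: "\<And>z. z \<in> S \<Longrightarrow> u z = (\<Sum>y\<in>S. P z y * (if y \<in> C then g y else u y))"
  shows "u x = (\<Sum>c\<in>C. entry_prob S P C {c} x * g c)"
proof -
  have finC: "finite C" using C(1) by (rule finite_subset) simp
  let ?v = "\<lambda>z. \<Sum>c\<in>C. entry_prob S P C {c} z * g c"
  have v: "?v z = (\<Sum>y\<in>S. P z y * (if y \<in> C then g y else ?v y))" if z: "z \<in> S" for z
  proof -
    have "?v z = (\<Sum>c\<in>C. (\<Sum>y\<in>S. P z y *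
        (if y \<in> C then (if y \<in> {c} then 1 else 0) else entry_prob S P C {c} y)) * g c)"
      using z by (intro sum.cong refl) (subst entry_step, auto)
    also have "\<dots> = (\<Sum>y\<in>S. \<Sum>c\<in>C. P z y *
        (if y \<in> C then (if y = c then g c else 0) else entry_prob S P C {c} y * g c))"
      unfolding sum_distrib_right by (subst sum.swap) (intro sum.cong refl, auto)
    also have "\<dots> = (\<Sum>y\<in>S. P z y * (if y \<in> C then g y else ?v y))"
      using finC by (intro sum.cong refl) (auto simp: sum_distrib_left[symmetric] sum.delta)
    finally show ?thesis .
  qed
  have "u x - ?v x = 0"
  proof (rule dirichlet_zero[OF C x])
    fix z assume z: "z \<in> S"
    show "u z - ?v z = (\<Sum>y\<in>S. P z y * (if y \<in> C then 0 else u y - ?v y))"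
      by (subst u[OF z], subst v[OF z], subst sum_subtractf[symmetric])
        (intro sum.cong refl, auto simp: algebra_simps)
  qed
  then show ?thesis by simp
qed

lemma entry_prob_additive:
  assumes "C \<subseteq> S" "C \<noteq> {}" "x \<in> S" "D \<subseteq> C"
  shows "entry_prob S P C D x = (\<Sum>c\<in>D. entry_prob S P C {c} x)"
proof -
  have finC: "finite C" using assms(1) by (rule finite_subset) simp
  have "entry_prob S P C D x = (\<Sum>c\<in>C. entry_prob S P C {c} x * (if c \<in> D then 1 else 0))"
    using assms by (intro dirichlet_entry_prob entry_step)
  also have "\<dots> = (\<Sum>c\<in>C. if c \<in> D then entry_prob S P C {c} x else 0)"
    by (intro sum.cong) auto
  also have "\<dots> = (\<Sum>c\<in>D. entry_prob S P C {c} x)"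
    using finC assms(4) by (simp add: sum.inter_restrict[symmetric] Int_absorb1)
  finally show ?thesis .
qed

text \<open>The constant 1 solves the Dirichlet problem with boundary values 1. Probabilistically,
  \<open>C\<close> is hit almost surely.\<close>

lemma entry_prob_total:
  assumes "C \<subseteq> S" "C \<noteq> {}" "x \<in> S"
  shows "(\<Sum>c\<in>C. entry_prob S P C {c} x) = 1"
  using dirichlet_entry_prob[of C x "\<lambda>_. 1" "\<lambda>_. 1"] assms by (simp add: row_sum)

text \<open>The zero set \<open>?Z\<close> of \<open>?g\<close> is absorbing by the first-step
  equation. It contains \<open>C - D\<close>, which is nonempty, so it is all of \<open>S\<close>;
  but \<open>?g\<close> is 1 on \<open>D\<close>.\<close>

lemma entry_prob_zero:
  assumes C: "C \<subseteq> S" "D \<subseteq> C" "D \<noteq> C" and z: "\<And>x. x \<in> C - D \<Longrightarrow> entry_prob S P C D x = 0"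
  shows "D = {}"
proof -
  let ?g = "\<lambda>y. if y \<in> C then (if y \<in> D then 1 else 0) else entry_prob S P C D y"
  let ?Z = "{y \<in> S. ?g y = 0}"
  have "absorbing S P ?Z"
    unfolding absorbing_def
  proof (intro conjI ballI)
    fix w y assume w: "w \<in> ?Z" and y: "y \<in> S - ?Z"
    then have "entry_prob S P C D w = 0" using z by (auto split: if_splits)
    then have "(\<Sum>y\<in>S. P w y * ?g y) = 0"
      using w C by (subst (asm) entry_step) auto
    then have "P w y * ?g y = 0"
      using w y by (subst (asm) sum_nonneg_eq_0_iff) (auto intro!: mult_nonneg_nonneg nonneg entry_prob_nonneg)
    then show "P w y = 0" using y by auto
  qed auto
  moreover have "?Z \<noteq> {}" using C by auto
  ultimately have "?Z = S" by (rule absorbing_eq)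
  then show ?thesis using C by (auto split: if_splits)
qed

text \<open>The trace on \<open>{x, z}\<close> is a two-state chain with invariant measure
  \<open>\<mu>\<close>, and for two states invariance means that the flows in the two directions
  balance.\<close>

lemma capacity_symmetric:
  assumes \<mu>: "stationary S P \<mu>" and "x \<in> S" "z \<in> S" "x \<noteq> z"
  shows "\<mu> x * entry_prob S P {x, z} {z} x = \<mu> z * entry_prob S P {x, z} {x} z"
proof -
  have "\<mu> x * entry_prob S P {x, z} {z} x + \<mu> z * entry_prob S P {x, z} {z} z = \<mu> z"
    using trace_invariant[OF \<mu>, of "{x, z}" z] assms by simp
  moreover have "entry_prob S P {x, z} {x} z + entry_prob S P {x, z} {z} z = 1"
    using entry_prob_total[of "{x, z}" z] assms by simp
  then have "entry_prob S P {x, z} {z} z = 1 - entry_prob S P {x, z} {x} z" by linarith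
  ultimately show ?thesis by (simp add: algebra_simps)
qed

end

lemma (in finite_chain) irreducible_essential_class:
  assumes "E \<in> essential_classes S P"
  shows "irreducible_finite_chain E P"
proof -
  interpret E: finite_chain E P by (rule essential_class_chain[OF assms])
  show ?thesis
    using essential_class_nonempty[OF assms] essential_class_minimal[OF assms] by unfold_locales
qed

lemma irreducible_finite_chainI:
  assumes S: "finite S" "stochastic S P" "S \<noteq> {}" and irr: "irreducible_chain S P"
  shows "irreducible_finite_chain S P"
proof -
  interpret finite_chain S P using S by unfold_locales
  show ?thesis
  proof
    fix T assume T: "absorbing S P T" "T \<noteq> {}"
    then obtain x where "x \<in> T" "x \<in> S" by (auto simp: absorbing_def)
    then show "T = S"
      using leads_to_in_absorbing[OF T(1), of x] irr T(1)
      unfolding irreducible_chain_def absorbing_def by blast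
  qed fact
qed

section \<open>Slowed trace chains and comparison of entry probabilities\<close>

context irreducible_finite_chain
begin

lemma entry_prob_pos:
  assumes "C \<subseteq> S" "x \<in> C" "D = C - {x}" "D \<noteq> {}"
  shows "0 < entry_prob S P C D x"
proof (rule ccontr)
  assume "\<not> 0 < entry_prob S P C D x"
  then have "entry_prob S P C D x = 0"
    using entry_prob_nonneg[of S P C D x] by linarith
  then have "D = {}"
    using assms by (intro entry_prob_zero[of C D]) auto
  with assms show False by simp
qed

text \<open>\<open>Q\<close> is the trace of the chain on \<open>C\<close>, slowed down at each \<open>u\<close> by the factor \<open>\<nu> u\<close>.\<close>
lemma slowed_trace_irreducible:
  assumes C: "C \<subseteq> S" "C \<noteq> {}"
    and \<nu>: "\<And>u. u \<in> C \<Longrightarrow> 0 < \<nu> u" "\<And>u. u \<in> C \<Longrightarrow> \<nu> u \<le> 1"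
    and Q: "\<And>u v. u \<in> C \<Longrightarrow> v \<in> C \<Longrightarrow>
      Q u v = \<nu> u * entry_prob S P C {v} u + (if u = v then 1 - \<nu> u else 0)"
  shows "irreducible_finite_chain C Q"
proof
  show finC: "finite C" using C(1) by (rule finite_subset) simp
  have "(\<Sum>v\<in>C. Q u v) = 1" if u: "u \<in> C" for u
  proof -
    have "u \<in> S" using C(1) u by blast
    have "(\<Sum>v\<in>C. Q u v) = \<nu> u * (\<Sum>v\<in>C. entry_prob S P C {v} u) + (\<Sum>v\<in>C. if u = v then 1 - \<nu> u else 0)"
      using u by (simp add: Q sum.distrib sum_distrib_left)
    then show ?thesis
      using entry_prob_total[OF C \<open>u \<in> S\<close>] finC u by simp
  qed
  moreover have "0 \<le> Q u v" if "u \<in> C" "v \<in> C" for u v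
    unfolding Q[OF that] using that \<nu>(1)[of u] \<nu>(2)[of u]
    by (intro add_nonneg_nonneg mult_nonneg_nonneg entry_prob_nonneg) auto
  ultimately show "stochastic C Q" by (simp add: stochastic_def)
  show "C \<noteq> {}" by fact
  fix T assume T: "absorbing C Q T" "T \<noteq> {}"
  have TC: "T \<subseteq> C" using T(1) by (simp add: absorbing_def)
  \<comment> \<open>From \<open>T\<close> the chain \<open>Q\<close> never steps to
    \<open>C - T\<close>. As \<open>\<nu> u > 0\<close>, the same holds for the entry probabilities
    of the original chain, and \<open>entry_prob_zero\<close> applies with
    \<open>D = C - T\<close>.\<close>
  have "C - T = {}"
  proof (rule entry_prob_zero[of C])
    fix u assume "u \<in> C - (C - T)"
    then have u: "u \<in> T" "u \<in> C" "u \<in> S" using C by auto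
    have "entry_prob S P C {v} u = 0" if v: "v \<in> C - T" for v
    proof -
      have "Q u v = 0" "u \<noteq> v" using T(1) u v by (auto simp: absorbing_def)
      then show ?thesis using Q[of u v] u v \<nu>(1)[of u] by simp
    qed
    then show "entry_prob S P C (C - T) u = 0"
      using entry_prob_additive[OF C u(3), of "C - T"] by simp
  qed (use C T TC in auto)
  then show "T = C" using TC by auto
qed

text \<open>Watching the chain only on \<open>C\<close> preserves the order in which
  \<open>x\<close> and \<open>z\<close> are visited. Holding at a third state merely delays the
  path, but a held step at \<open>x\<close> counts as a return to \<open>x\<close>, which costs the
  factor \<open>\<nu> x\<close>.\<close>

lemma slowed_trace_entry_prob:
  assumes C: "C \<subseteq> S" and x: "x \<in> C" and z: "z \<in> C" "x \<noteq> z"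
    and \<nu>: "\<And>u. u \<in> C \<Longrightarrow> 0 < \<nu> u" "\<And>u. u \<in> C \<Longrightarrow> \<nu> u \<le> 1"
    and Q: "\<And>u v. u \<in> C \<Longrightarrow> v \<in> C \<Longrightarrow>
      Q u v = \<nu> u * entry_prob S P C {v} u + (if u = v then 1 - \<nu> u else 0)"
  shows "entry_prob C Q {x, z} {z} x = \<nu> x * entry_prob S P {x, z} {z} x"
proof -
  have C_ne: "C \<noteq> {}" using x by blast
  have finC: "finite C" using C by (rule finite_subset) simp
  interpret Q: irreducible_finite_chain C Q
    using C C_ne \<nu> Q by (rule slowed_trace_irreducible)
  let ?H = "entry_prob S P {x, z} {z}"
  let ?G = "\<lambda>v. if v \<in> {x, z} then (if v \<in> {z} then 1 else 0) else ?H v"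
  \<comment> \<open>The path to \<open>{x, z}\<close> is split at its first visit to
    \<open>C\<close> at a positive time; \<open>?G\<close> is the value seen there.\<close>
  have H: "?H w = (\<Sum>v\<in>C. entry_prob S P C {v} w * ?G v)" if w: "w \<in> S" for w
  proof (rule dirichlet_entry_prob[OF C C_ne w, where u = ?H and g = ?G])
    fix w assume w: "w \<in> S"
    show "?H w = (\<Sum>y\<in>S. P w y * (if y \<in> C then ?G y else ?H y))"
      using x z by (subst entry_step[OF w]) (auto intro!: sum.cong)
  qed
  \<comment> \<open>Candidate solution for \<open>Q\<close>: with weight \<open>\<nu> w\<close> a
    move of the trace is made, with weight \<open>1 - \<nu> w\<close> the chain holds and sees the
    value at \<open>w\<close> itself. At \<open>x\<close> that value is 0.\<close>
  define u where "u w = \<nu> w * ?H w + (1 - \<nu> w) * ?G w" for w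
  have "u x = (\<Sum>c\<in>{x, z}. entry_prob C Q {x, z} {c} x * (if c \<in> {z} then 1 else 0))"
  proof (rule Q.dirichlet_entry_prob[where u = u and g = "\<lambda>c. if c \<in> {z} then 1 else 0"])
    fix w assume w: "w \<in> C"
    have wS: "w \<in> S" using C w by blast
    have "(\<Sum>v\<in>C. Q w v * ?G v) =
        \<nu> w * (\<Sum>v\<in>C. entry_prob S P C {v} w * ?G v) + (\<Sum>v\<in>C. if w = v then (1 - \<nu> w) * ?G v else 0)"
      unfolding sum_distrib_left sum.distrib[symmetric]
      using w by (intro sum.cong refl) (simp add: Q algebra_simps)
    also have "\<dots> = u w"
      using w finC H[OF wS] by (simp add: u_def)
    finally have "u w = (\<Sum>v\<in>C. Q w v * ?G v)" by simp
    \<comment> \<open>Off \<open>{x, z}\<close> the functions \<open>?G\<close> and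
      \<open>?H\<close> agree, so there \<open>u\<close> equals both.\<close>
    also have "\<dots> = (\<Sum>v\<in>C. Q w v * (if v \<in> {x, z} then (if v \<in> {z} then 1 else 0) else u v))"
      by (intro sum.cong refl) (auto simp: u_def algebra_simps)
    finally show "u w = \<dots>" .
  qed (use x z in auto)
  also have "\<dots> = entry_prob C Q {x, z} {z} x" using z by simp
  finally show ?thesis using z by (simp add: u_def)
qed

text \<open>The trace leaves \<open>\<mu>\<close> on \<open>C\<close> invariant, and slowing down at
  \<open>u\<close> lengthens the mean stay there by the factor \<open>1 / \<nu> u\<close>. Hence the
  weights \<open>\<mu> u / \<nu> u\<close>, normalised.\<close>

lemma slowed_trace_stationary:
  assumes C: "C \<subseteq> S" "C \<noteq> {}" and \<mu>: "stationary S P \<mu>"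
    and \<nu>: "\<And>u. u \<in> C \<Longrightarrow> 0 < \<nu> u" "\<And>u. u \<in> C \<Longrightarrow> \<nu> u \<le> 1"
    and Q: "\<And>u v. u \<in> C \<Longrightarrow> v \<in> C \<Longrightarrow>
      Q u v = \<nu> u * entry_prob S P C {v} u + (if u = v then 1 - \<nu> u else 0)"
  shows "stationary C Q (\<lambda>u. \<mu> u / \<nu> u / (\<Sum>v\<in>C. \<mu> v / \<nu> v))"
proof -
  define Z where "Z = (\<Sum>v\<in>C. \<mu> v / \<nu> v)"
  have finC: "finite C" using C(1) by (rule finite_subset) simp
  have pos: "0 < \<mu> u / \<nu> u" if "u \<in> C" for u
    using stationary_pos[OF \<mu>, of u] \<nu>(1)[OF that] C(1) that by auto
  have Z: "0 < Z" unfolding Z_def using finC C(2) pos by (intro sum_pos) auto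
  have inv: "(\<Sum>u\<in>C. \<mu> u / \<nu> u * Q u v) = \<mu> v / \<nu> v" if v: "v \<in> C" for v
  proof -
    have "(\<Sum>u\<in>C. \<mu> u / \<nu> u * Q u v) =
        (\<Sum>u\<in>C. \<mu> u * entry_prob S P C {v} u + (if u = v then \<mu> u / \<nu> u - \<mu> u else 0))"
    proof (intro sum.cong refl)
      fix u assume u: "u \<in> C"
      have "\<mu> u / \<nu> u * (if u = v then 1 - \<nu> u else 0) = (if u = v then \<mu> u / \<nu> u - \<mu> u else 0)"
        using \<nu>(1)[OF u] by (auto simp: field_simps)
      then show "\<mu> u / \<nu> u * Q u v = \<mu> u * entry_prob S P C {v} u + (if u = v then \<mu> u / \<nu> u - \<mu> u else 0)"
        using \<nu>(1)[OF u] unfolding Q[OF u v] distrib_left by simp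
    qed
    also have "\<dots> = \<mu> v + (\<mu> v / \<nu> v - \<mu> v)"
      unfolding sum.distrib trace_invariant[OF \<mu> C(1) v] using finC v by (simp add: sum.delta)
    finally show ?thesis by simp
  qed
  have "(\<Sum>u\<in>C. \<mu> u / \<nu> u / Z) = 1"
    unfolding sum_divide_distrib[symmetric] using Z by (simp add: Z_def)
  moreover have "(\<Sum>u\<in>C. \<mu> u / \<nu> u / Z * Q u v) = \<mu> v / \<nu> v / Z" if "v \<in> C" for v
  proof -
    have "(\<Sum>u\<in>C. \<mu> u / \<nu> u / Z * Q u v) = (\<Sum>u\<in>C. \<mu> u / \<nu> u * Q u v) / Z"
      unfolding sum_divide_distrib by (intro sum.cong) auto
    then show ?thesis using inv[OF that] by simp
  qed
  moreover have "0 \<le> \<mu> u / \<nu> u / Z" if "u \<in> C" for u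
    using divide_pos_pos[OF pos[OF that] Z] by (rule less_imp_le)
  ultimately show ?thesis unfolding stationary_def Z_def[symmetric] by blast
qed

text \<open>The quotient is the mean, over the point where the chain enters \<open>E\<close>, of the probability to
  reach \<open>z\<close> from there before \<open>x\<close>.\<close>
lemma entry_prob_point_vs_set:
  assumes E: "E \<subseteq> S" "z \<in> E" "x \<in> S - E"
  shows "\<bar>entry_prob S P {x, z} {z} x / entry_prob S P (E \<union> {x}) E x - 1\<bar> \<le>
    (\<Sum>c\<in>E - {z}. 1 - entry_prob S P {x, z} {z} c)"
proof -
  let ?C = "E \<union> {x}"
  have finE: "finite E" using E(1) by (rule finite_subset) simp
  let ?u = "entry_prob S P {x, z} {z}"
  \<comment> \<open>The value at the entry point of \<open>E \<union> {x}\<close>: failure at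
    \<open>x\<close>, success at \<open>z\<close>, and otherwise the chance to go on to
    \<open>z\<close> before \<open>x\<close>.\<close>
  let ?g = "\<lambda>y. if y = x then 0 else if y = z then 1 else ?u y"
  let ?a = "\<lambda>c. entry_prob S P ?C {c} x"
  have a: "entry_prob S P ?C E x = (\<Sum>c\<in>E. ?a c)"
    using E by (intro entry_prob_additive) auto
  have pos: "0 < entry_prob S P ?C E x"
    using E by (intro entry_prob_pos) auto
  have "?u x = (\<Sum>c\<in>?C. ?a c * ?g c)"
  proof (rule dirichlet_entry_prob[where u = ?u and g = ?g])
    fix w assume w: "w \<in> S"
    show "?u w = (\<Sum>y\<in>S. P w y * (if y \<in> ?C then ?g y else ?u y))"
      using E by (subst entry_step[OF w]) (auto intro!: sum.cong)
  qed (use E in auto)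
  also have "\<dots> = (\<Sum>c\<in>E. ?a c * ?g c)"
    using E finE by simp
  finally have u: "?u x = (\<Sum>c\<in>E. ?a c * ?g c)" .
  have g: "0 \<le> 1 - ?g c" "?g c \<le> 1" if "c \<in> E" for c
    using entry_prob_bounds[of c] E that by auto
  \<comment> \<open>Bounding each defect by the sum of all of them gives an estimate free of the
    entry distribution \<open>?a\<close>, about which nothing is known.\<close>
  have g_le: "1 - ?g c \<le> (\<Sum>c\<in>E. 1 - ?g c)" if "c \<in> E" for c
    using finE that g by (intro member_le_sum) auto
  have "entry_prob S P ?C E x - ?u x = (\<Sum>c\<in>E. ?a c * (1 - ?g c))"
    unfolding a u sum_subtractf[symmetric] by (simp add: algebra_simps)
  moreover have "0 \<le> (\<Sum>c\<in>E. ?a c * (1 - ?g c))"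
    using g by (intro sum_nonneg mult_nonneg_nonneg entry_prob_nonneg)
  moreover have "(\<Sum>c\<in>E. ?a c * (1 - ?g c)) \<le> (\<Sum>c\<in>E. ?a c * (\<Sum>c\<in>E. 1 - ?g c))"
    using g_le by (intro sum_mono mult_left_mono entry_prob_nonneg)
  moreover have "(\<Sum>c\<in>E. ?a c * (\<Sum>c\<in>E. 1 - ?g c)) = entry_prob S P ?C E x * (\<Sum>c\<in>E. 1 - ?g c)"
    unfolding a by (rule sum_distrib_right[symmetric])
  ultimately have "\<bar>?u x - entry_prob S P ?C E x\<bar> \<le> entry_prob S P ?C E x * (\<Sum>c\<in>E. 1 - ?g c)"
    by linarith
  moreover have "?u x / entry_prob S P ?C E x - 1 = (?u x - entry_prob S P ?C E x) / entry_prob S P ?C E x"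
    using pos by (simp add: diff_divide_distrib)
  moreover have "(\<Sum>c\<in>E. 1 - ?g c) = (\<Sum>c\<in>E - {z}. 1 - ?u c)"
    using E finE by (intro sum.mono_neutral_cong_right) auto
  ultimately show ?thesis
    using pos by (simp add: pos_divide_le_eq mult.commute)
qed

end

section \<open>Perturbed chains\<close>

locale perturbed_irreducible_chain =
  fixes S :: "'a set" and P :: "real \<Rightarrow> 'a \<Rightarrow> 'a \<Rightarrow> real"
  assumes chain0: "finite_chain S (P 0)"
    and irreducible: "0 < \<epsilon> \<Longrightarrow> irreducible_finite_chain S (P \<epsilon>)"
    and limit: "x \<in> S \<Longrightarrow> y \<in> S \<Longrightarrow> ((\<lambda>\<epsilon>. P \<epsilon> x y) \<longlongrightarrow> P 0 x y) (at_right 0)"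
begin

sublocale chain0: finite_chain S "P 0" by (rule chain0)

abbreviation \<mu> where "\<mu> \<epsilon> \<equiv> stat_dist S (P \<epsilon>)"
abbreviation \<nu> where "\<nu> E \<equiv> stat_dist E (P 0)"
abbreviation mass where "mass \<epsilon> E \<equiv> \<Sum>x\<in>E. stat_dist S (P \<epsilon>) x"
abbreviation classes where "classes \<equiv> essential_classes S (P 0)"

lemma eventually_pos: "(\<And>\<epsilon>. 0 < \<epsilon> \<Longrightarrow> Q \<epsilon>) \<Longrightarrow> eventually Q (at_right (0::real))"
  using eventually_at_right_less[of "0::real"] by (rule eventually_mono)

section \<open>Limits of the stationary distributions\<close>

lemma stat: "0 < \<epsilon> \<Longrightarrow> stationary S (P \<epsilon>) (\<mu> \<epsilon>)"
  by (rule irreducible_finite_chain.stationary_stat_dist[OF irreducible])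

lemma stat_pos: "0 < \<epsilon> \<Longrightarrow> x \<in> S \<Longrightarrow> 0 < \<mu> \<epsilon> x"
  by (rule irreducible_finite_chain.stat_dist_pos[OF irreducible])

lemma class_subset: "E \<in> classes \<Longrightarrow> E \<subseteq> S"
  using chain0.absorbing_essential_class by (auto simp: absorbing_def)

lemma class_finite: "E \<in> classes \<Longrightarrow> finite E"
  by (rule finite_subset[OF class_subset]) simp_all

lemma mass_pos:
  assumes "0 < \<epsilon>" "E \<in> classes"
  shows "0 < mass \<epsilon> E"
  using assms class_finite class_subset[OF assms(2)] chain0.essential_class_nonempty stat_pos
  by (intro sum_pos) auto

lemma mass_le_1:
  assumes "0 < \<epsilon>" "E \<in> classes"
  shows "mass \<epsilon> E \<le> 1"
proof -
  have "mass \<epsilon> E \<le> mass \<epsilon> S"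
    using assms class_subset stat_pos by (intro sum_mono2) (auto simp: less_imp_le)
  also have "\<dots> = 1" using stat[OF assms(1)] by (simp add: stationary_def)
  finally show ?thesis .
qed

lemma class_stat_pos: "E \<in> classes \<Longrightarrow> x \<in> E \<Longrightarrow> 0 < \<nu> E x"
  by (rule irreducible_finite_chain.stat_dist_pos[OF chain0.irreducible_essential_class])

lemma class_stat: "E \<in> classes \<Longrightarrow> stationary E (P 0) (\<nu> E)"
  by (rule irreducible_finite_chain.stationary_stat_dist[OF chain0.irreducible_essential_class])

lemma class_stat_le_1:
  assumes "E \<in> classes" "x \<in> E"
  shows "\<nu> E x \<le> 1"
  using member_le_sum[of x E "\<nu> E"] class_finite[OF assms(1)] class_stat[OF assms(1)] assms(2)
  by (auto simp: stationary_def)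

text \<open>Each cluster point \<open>c\<close> of the conditioned distributions is stationary for
  \<open>P 0\<close> on \<open>E\<close>, and the stationary distribution there is unique. The flow
  from \<open>S - E\<close> is dropped, which at first leaves only an inequality in the
  limit.\<close>

lemma conditioned_stat_limit:
  assumes E: "E \<in> classes" and y: "y \<in> E"
  shows "((\<lambda>\<epsilon>. \<mu> \<epsilon> y / mass \<epsilon> E) \<longlongrightarrow> \<nu> E y) (at_right 0)"
proof (rule tendsto_by_subfilters[where S = E])
  have ES: "E \<subseteq> S" and finE: "finite E" using E class_subset class_finite by auto
  have nonneg: "0 \<le> \<mu> \<epsilon> x / mass \<epsilon> E" if "0 < \<epsilon>" "x \<in> E" for \<epsilon> x
    using that ES stat_pos[of \<epsilon> x] mass_pos[OF _ E, of \<epsilon>] by (auto simp: less_imp_le)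
  have sum1: "(\<Sum>x\<in>E. \<mu> \<epsilon> x / mass \<epsilon> E) = 1" if "0 < \<epsilon>" for \<epsilon>
    using mass_pos[OF that E] by (simp add: sum_divide_distrib[symmetric])
  show "finite E" "y \<in> E" by fact+
  show "eventually (\<lambda>\<epsilon>. \<mu> \<epsilon> x / mass \<epsilon> E \<in> {0..1}) (at_right 0)" if "x \<in> E" for x
  proof (rule eventually_pos)
    fix \<epsilon> :: real assume "0 < \<epsilon>"
    then have "\<mu> \<epsilon> x / mass \<epsilon> E \<le> (\<Sum>x\<in>E. \<mu> \<epsilon> x / mass \<epsilon> E)"
      using that finE nonneg by (intro member_le_sum[of x E "\<lambda>x. \<mu> \<epsilon> x / mass \<epsilon> E"]) auto
    then show "\<mu> \<epsilon> x / mass \<epsilon> E \<in> {0..1}"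
      using \<open>0 < \<epsilon>\<close> sum1 nonneg that by auto
  qed
  fix G :: "real filter" and c
  assume G: "G \<le> at_right 0" "G \<noteq> bot"
    and c: "\<And>x. x \<in> E \<Longrightarrow> ((\<lambda>\<epsilon>. \<mu> \<epsilon> x / mass \<epsilon> E) \<longlongrightarrow> c x) G"
  have ev: "eventually Q G" if "\<And>\<epsilon>. 0 < \<epsilon> \<Longrightarrow> Q \<epsilon>" for Q
    using eventually_pos[of Q, OF that] G(1) by (auto simp: le_filter_def)
  have c_nonneg: "0 \<le> c x" if "x \<in> E" for x
    by (rule tendsto_lowerbound[OF c[OF that] ev G(2)]) (use that nonneg in auto)
  have c_sum: "(\<Sum>x\<in>E. c x) = 1"
  proof (rule tendsto_unique[OF G(2)])
    show "((\<lambda>\<epsilon>. \<Sum>x\<in>E. \<mu> \<epsilon> x / mass \<epsilon> E) \<longlongrightarrow> (\<Sum>x\<in>E. c x)) G"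
      by (intro tendsto_sum c)
    show "((\<lambda>\<epsilon>. \<Sum>x\<in>E. \<mu> \<epsilon> x / mass \<epsilon> E) \<longlongrightarrow> 1) G"
      by (rule tendsto_eventually, rule ev) (rule sum1)
  qed
  have le: "(\<Sum>x\<in>E. c x * P 0 x y) \<le> c y" if y: "y \<in> E" for y
  proof (rule tendsto_le[OF G(2) c[OF y]])
    show "((\<lambda>\<epsilon>. \<Sum>x\<in>E. \<mu> \<epsilon> x / mass \<epsilon> E * P \<epsilon> x y) \<longlongrightarrow> (\<Sum>x\<in>E. c x * P 0 x y)) G"
      using y ES by (intro tendsto_sum tendsto_mult c tendsto_mono[OF G(1) limit]) auto
    show "eventually (\<lambda>\<epsilon>. (\<Sum>x\<in>E. \<mu> \<epsilon> x / mass \<epsilon> E * P \<epsilon> x y) \<le> \<mu> \<epsilon> y / mass \<epsilon> E) G"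
    proof (rule ev)
      fix \<epsilon> :: real assume \<epsilon>: "0 < \<epsilon>"
      interpret irreducible_finite_chain S "P \<epsilon>" by (rule irreducible[OF \<epsilon>])
      have "(\<Sum>x\<in>E. \<mu> \<epsilon> x * P \<epsilon> x y) \<le> (\<Sum>x\<in>S. \<mu> \<epsilon> x * P \<epsilon> x y)"
        using ES y stat_pos[OF \<epsilon>] nonneg
        by (intro sum_mono2) (auto intro!: mult_nonneg_nonneg simp: less_imp_le)
      also have "\<dots> = \<mu> \<epsilon> y" using stat[OF \<epsilon>] ES y by (auto simp: stationary_def)
      finally have "(\<Sum>x\<in>E. \<mu> \<epsilon> x * P \<epsilon> x y) / mass \<epsilon> E \<le> \<mu> \<epsilon> y / mass \<epsilon> E"
        using mass_pos[OF \<epsilon> E] by (intro divide_right_mono) auto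
      then show "(\<Sum>x\<in>E. \<mu> \<epsilon> x / mass \<epsilon> E * P \<epsilon> x y) \<le> \<mu> \<epsilon> y / mass \<epsilon> E"
        by (simp add: sum_divide_distrib)
    qed
  qed
  interpret E: irreducible_finite_chain E "P 0" by (rule chain0.irreducible_essential_class[OF E])
  \<comment> \<open>Rows of \<open>P 0\<close> on \<open>E\<close> sum to 1, so the two sides of
    \<open>le\<close> have the same total over \<open>E\<close>, and nonnegative deficits with sum 0
    vanish.\<close>
  have "(\<Sum>y\<in>E. \<Sum>x\<in>E. c x * P 0 x y) = (\<Sum>x\<in>E. c x)"
    by (subst sum.swap) (simp add: sum_distrib_left[symmetric] E.row_sum)
  then have "(\<Sum>y\<in>E. c y - (\<Sum>x\<in>E. c x * P 0 x y)) = 0"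
    by (simp add: sum_subtractf)
  then have "(\<Sum>x\<in>E. c x * P 0 x y) = c y" if "y \<in> E" for y
    using that le finE by (subst (asm) sum_nonneg_eq_0_iff) auto
  then have "stationary E (P 0) c"
    using c_nonneg c_sum by (simp add: stationary_def)
  then show "c y = \<nu> E y" using y by (simp add: E.stat_dist_eq)
qed

text \<open>Cluster points of \<open>\<mu> \<epsilon>\<close> are stationary for \<open>P 0\<close>.
  Several stationary distributions may exist, but all of them vanish outside the essential
  classes.\<close>

lemma transient_stat_limit:
  assumes x: "x \<in> S" "x \<notin> \<Union>classes"
  shows "((\<lambda>\<epsilon>. \<mu> \<epsilon> x) \<longlongrightarrow> 0) (at_right 0)"
proof (rule tendsto_by_subfilters[where S = S])
  show "finite S" "x \<in> S" by (simp_all add: x)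
  show "eventually (\<lambda>\<epsilon>. \<mu> \<epsilon> x \<in> {0..1}) (at_right 0)" if "x \<in> S" for x
  proof (rule eventually_pos)
    fix \<epsilon> :: real assume \<epsilon>: "0 < \<epsilon>"
    have "\<mu> \<epsilon> x \<le> mass \<epsilon> S"
      using that stat_pos[OF \<epsilon>] by (intro member_le_sum) (auto simp: less_imp_le)
    then show "\<mu> \<epsilon> x \<in> {0..1}"
      using stat[OF \<epsilon>] that by (auto simp: stationary_def)
  qed
  fix G :: "real filter" and c
  assume G: "G \<le> at_right 0" "G \<noteq> bot" and c: "\<And>x. x \<in> S \<Longrightarrow> ((\<lambda>\<epsilon>. \<mu> \<epsilon> x) \<longlongrightarrow> c x) G"
  have ev: "eventually Q G" if "\<And>\<epsilon>. 0 < \<epsilon> \<Longrightarrow> Q \<epsilon>" for Q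
    using eventually_pos[of Q, OF that] G(1) by (auto simp: le_filter_def)
  have "stationary S (P 0) c"
    unfolding stationary_def
  proof (intro conjI ballI)
    show "0 \<le> c x" if "x \<in> S" for x
      by (rule tendsto_lowerbound[OF c[OF that] ev G(2)]) (use that stat_pos in \<open>auto simp: less_imp_le\<close>)
    show "(\<Sum>x\<in>S. c x) = 1"
    proof (rule tendsto_unique[OF G(2)])
      show "((\<lambda>\<epsilon>. mass \<epsilon> S) \<longlongrightarrow> (\<Sum>x\<in>S. c x)) G" by (intro tendsto_sum c)
      show "((\<lambda>\<epsilon>. mass \<epsilon> S) \<longlongrightarrow> 1) G"
        by (rule tendsto_eventually, rule ev) (use stat in \<open>auto simp: stationary_def\<close>)
    qed
    show "(\<Sum>x\<in>S. c x * P 0 x y) = c y" if y: "y \<in> S" for y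
    proof (rule tendsto_unique[OF G(2)])
      show "((\<lambda>\<epsilon>. \<Sum>x\<in>S. \<mu> \<epsilon> x * P \<epsilon> x y) \<longlongrightarrow> (\<Sum>x\<in>S. c x * P 0 x y)) G"
        using y by (intro tendsto_sum tendsto_mult c tendsto_mono[OF G(1) limit])
      have "eventually (\<lambda>\<epsilon>. \<mu> \<epsilon> y = (\<Sum>x\<in>S. \<mu> \<epsilon> x * P \<epsilon> x y)) G"
        by (rule ev) (use stat y in \<open>auto simp: stationary_def\<close>)
      then show "((\<lambda>\<epsilon>. \<Sum>x\<in>S. \<mu> \<epsilon> x * P \<epsilon> x y) \<longlongrightarrow> c y) G"
        using c[OF y] by (simp cong: tendsto_cong add: tendsto_cong)
    qed
  qed
  then show "c x = 0" using x by (rule chain0.stationary_mass_transient)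
qed

text \<open>Later determines the limit of the normalising constant in the stationary distribution of
  the slowed trace.\<close>

lemma classes_mass_limit: "((\<lambda>\<epsilon>. \<Sum>E\<in>classes. mass \<epsilon> E) \<longlongrightarrow> 1) (at_right 0)"
proof -
  let ?U = "\<Union>classes"
  have US: "?U \<subseteq> S" using class_subset by blast
  have "(\<Sum>E\<in>classes. mass \<epsilon> E) = mass \<epsilon> ?U" for \<epsilon>
    using class_finite chain0.essential_classes_disjoint
    by (subst sum.Union_disjoint) auto
  moreover have "mass \<epsilon> ?U = 1 - mass \<epsilon> (S - ?U)" if "0 < \<epsilon>" for \<epsilon>
    using stat[OF that] US by (simp add: stationary_def sum_diff)
  ultimately have "eventually (\<lambda>\<epsilon>. 1 - mass \<epsilon> (S - ?U) = (\<Sum>E\<in>classes. mass \<epsilon> E)) (at_right 0)"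
    by (intro eventually_pos) simp
  moreover have "((\<lambda>\<epsilon>. 1 - mass \<epsilon> (S - ?U)) \<longlongrightarrow> 1 - (\<Sum>x\<in>S - ?U. 0)) (at_right 0)"
    by (intro tendsto_diff tendsto_const tendsto_sum transient_stat_limit) auto
  ultimately have "((\<lambda>\<epsilon>. \<Sum>E\<in>classes. mass \<epsilon> E) \<longlongrightarrow> 1 - (\<Sum>x\<in>S - ?U. 0)) (at_right 0)"
    by (rule Lim_transform_eventually[rotated])
  then show ?thesis by simp
qed

section \<open>Asymptotics of entry and escape probabilities\<close>

lemma entry_prob_in_class_limit:
  assumes E: "E \<in> classes" and y: "y \<in> E" and z: "z \<in> E" and x: "x \<in> S - E"
  shows "((\<lambda>\<epsilon>. entry_prob S (P \<epsilon>) {x, z} {z} y) \<longlongrightarrow> 1) (at_right 0)"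
proof -
  have ES: "E \<subseteq> S" using E by (rule class_subset)
  have yzS: "y \<in> S" "z \<in> S" "x \<noteq> z" using y z x ES by auto
  \<comment> \<open>The complementary event is treated: a cluster point \<open>c\<close> of the
    probabilities to hit \<open>x\<close> before \<open>z\<close> satisfies the first-step equations
    of \<open>P 0\<close>.\<close>
  have "((\<lambda>\<epsilon>. entry_prob S (P \<epsilon>) {x, z} {x} y) \<longlongrightarrow> 0) (at_right 0)"
  proof (rule tendsto_by_subfilters[where S = S])
    show "finite S" "y \<in> S" using yzS by simp_all
    show "eventually (\<lambda>\<epsilon>. entry_prob S (P \<epsilon>) {x, z} {x} w \<in> {0..1}) (at_right 0)" if "w \<in> S" for w
    proof (rule eventually_pos)
      fix \<epsilon> :: real assume "0 < \<epsilon>"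
      then interpret irreducible_finite_chain S "P \<epsilon>" by (rule irreducible)
      show "entry_prob S (P \<epsilon>) {x, z} {x} w \<in> {0..1}" using entry_prob_bounds[OF that] by simp
    qed
    fix G :: "real filter" and c
    assume G: "G \<le> at_right 0" "G \<noteq> bot"
      and c: "\<And>w. w \<in> S \<Longrightarrow> ((\<lambda>\<epsilon>. entry_prob S (P \<epsilon>) {x, z} {x} w) \<longlongrightarrow> c w) G"
    have ev: "eventually Q G" if "\<And>\<epsilon>. 0 < \<epsilon> \<Longrightarrow> Q \<epsilon>" for Q
      using eventually_pos[of Q, OF that] G(1) by (auto simp: le_filter_def)
    let ?g = "\<lambda>c v. if v \<in> {x, z} then (if v \<in> {x} then 1 else 0) else c v"
    have step: "c w = (\<Sum>v\<in>S. P 0 w v * ?g c v)" if w: "w \<in> S" for w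
    proof (rule tendsto_unique[OF G(2) c[OF w]])
      have "((\<lambda>\<epsilon>. ?g (entry_prob S (P \<epsilon>) {x, z} {x}) v) \<longlongrightarrow> ?g c v) G" if "v \<in> S" for v
        using c[OF that] by auto
      then have "((\<lambda>\<epsilon>. \<Sum>v\<in>S. P \<epsilon> w v * ?g (entry_prob S (P \<epsilon>) {x, z} {x}) v) \<longlongrightarrow>
          (\<Sum>v\<in>S. P 0 w v * ?g c v)) G"
        using w by (intro tendsto_sum tendsto_mult tendsto_mono[OF G(1) limit])
      moreover have "eventually (\<lambda>\<epsilon>. (\<Sum>v\<in>S. P \<epsilon> w v * ?g (entry_prob S (P \<epsilon>) {x, z} {x}) v) =
          entry_prob S (P \<epsilon>) {x, z} {x} w) G"
      proof (rule ev)
        fix \<epsilon> :: real assume "0 < \<epsilon>"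
        then interpret irreducible_finite_chain S "P \<epsilon>" by (rule irreducible)
        show "(\<Sum>v\<in>S. P \<epsilon> w v * ?g (entry_prob S (P \<epsilon>) {x, z} {x}) v) = entry_prob S (P \<epsilon>) {x, z} {x} w"
          using w by (intro entry_step[symmetric]) auto
      qed
      ultimately show "((\<lambda>\<epsilon>. entry_prob S (P \<epsilon>) {x, z} {x} w) \<longlongrightarrow> (\<Sum>v\<in>S. P 0 w v * ?g c v)) G"
        by (rule Lim_transform_eventually)
    qed
    interpret E: irreducible_finite_chain E "P 0" by (rule chain0.irreducible_essential_class[OF E])
    \<comment> \<open>Under \<open>P 0\<close> the class \<open>E\<close> is never left, so
      \<open>x\<close> is out of reach. Restricted to \<open>E\<close>, the equations have the
      boundary value 0 at \<open>z\<close> only, and the maximum principle on \<open>E\<close>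
      applies.\<close>
    show "c y = 0"
    proof (rule E.dirichlet_zero[where C = "{z}"])
      fix w assume w: "w \<in> E"
      have "c w = (\<Sum>v\<in>E. P 0 w v * ?g c v)"
        unfolding step[OF subsetD[OF ES w]]
        using chain0.absorbing_essential_class[OF E] w
        by (intro sum.mono_neutral_right) (auto simp: absorbing_def)
      also have "\<dots> = (\<Sum>v\<in>E. P 0 w v * (if v \<in> {z} then 0 else c v))"
        using x yzS by (intro sum.cong) auto
      finally show "c w = \<dots>" .
    qed (use y z in auto)
  qed
  then have "((\<lambda>\<epsilon>. 1 - entry_prob S (P \<epsilon>) {x, z} {x} y) \<longlongrightarrow> 1 - 0) (at_right 0)"
    by (intro tendsto_intros)
  moreover have "eventually (\<lambda>\<epsilon>. 1 - entry_prob S (P \<epsilon>) {x, z} {x} y = entry_prob S (P \<epsilon>) {x, z} {z} y)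
      (at_right 0)"
  proof (rule eventually_pos)
    fix \<epsilon> :: real assume "0 < \<epsilon>"
    then interpret irreducible_finite_chain S "P \<epsilon>" by (rule irreducible)
    show "1 - entry_prob S (P \<epsilon>) {x, z} {x} y = entry_prob S (P \<epsilon>) {x, z} {z} y"
      using entry_prob_total[of "{x, z}" y] x yzS by simp
  qed
  ultimately have "((\<lambda>\<epsilon>. entry_prob S (P \<epsilon>) {x, z} {z} y) \<longlongrightarrow> 1 - 0) (at_right 0)"
    by (rule Lim_transform_eventually)
  then show ?thesis by simp
qed

text \<open>From any point of \<open>E\<close> the chain visits \<open>z\<close> before
  \<open>x\<close> with probability tending to 1, so all defects in the bound of
  \<open>entry_prob_point_vs_set\<close> tend to 0.\<close>

lemma entry_prob_point_equiv_set:
  assumes E: "E \<in> classes" and z: "z \<in> E" and x: "x \<in> S - E"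
  shows "((\<lambda>\<epsilon>. entry_prob S (P \<epsilon>) {x, z} {z} x / entry_prob S (P \<epsilon>) (E \<union> {x}) E x) \<longlongrightarrow> 1) (at_right 0)"
proof -
  have "((\<lambda>\<epsilon>. entry_prob S (P \<epsilon>) {x, z} {z} x / entry_prob S (P \<epsilon>) (E \<union> {x}) E x - 1) \<longlongrightarrow> 0) (at_right 0)"
  proof (rule Lim_null_comparison)
    show "eventually (\<lambda>\<epsilon>. norm (entry_prob S (P \<epsilon>) {x, z} {z} x / entry_prob S (P \<epsilon>) (E \<union> {x}) E x - 1)
        \<le> (\<Sum>c\<in>E - {z}. 1 - entry_prob S (P \<epsilon>) {x, z} {z} c)) (at_right 0)"
    proof (rule eventually_pos)
      fix \<epsilon> :: real assume "0 < \<epsilon>"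
      then interpret irreducible_finite_chain S "P \<epsilon>" by (rule irreducible)
      show "norm (entry_prob S (P \<epsilon>) {x, z} {z} x / entry_prob S (P \<epsilon>) (E \<union> {x}) E x - 1)
          \<le> (\<Sum>c\<in>E - {z}. 1 - entry_prob S (P \<epsilon>) {x, z} {z} c)"
        unfolding real_norm_def using class_subset[OF E] z x by (rule entry_prob_point_vs_set)
    qed
    have "((\<lambda>\<epsilon>. \<Sum>c\<in>E - {z}. 1 - entry_prob S (P \<epsilon>) {x, z} {z} c) \<longlongrightarrow> (\<Sum>c\<in>E - {z}. 1 - 1)) (at_right 0)"
      using E z x by (intro tendsto_sum tendsto_diff tendsto_const entry_prob_in_class_limit) auto
    then show "((\<lambda>\<epsilon>. \<Sum>c\<in>E - {z}. 1 - entry_prob S (P \<epsilon>) {x, z} {z} c) \<longlongrightarrow> 0) (at_right 0)"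
      by simp
  qed
  then show ?thesis by (simp add: LIM_zero_iff)
qed

lemma conditioned_stat_ratio_limit:
  assumes E: "E \<in> classes" and x: "x \<in> E" and y: "y \<in> E"
  shows "((\<lambda>\<epsilon>. \<mu> \<epsilon> x / \<mu> \<epsilon> y) \<longlongrightarrow> \<nu> E x / \<nu> E y) (at_right 0)"
proof -
  have "((\<lambda>\<epsilon>. (\<mu> \<epsilon> x / mass \<epsilon> E) / (\<mu> \<epsilon> y / mass \<epsilon> E)) \<longlongrightarrow> \<nu> E x / \<nu> E y) (at_right 0)"
    using class_stat_pos[OF E y] by (intro tendsto_divide conditioned_stat_limit E x y) simp
  moreover have "eventually (\<lambda>\<epsilon>. (\<mu> \<epsilon> x / mass \<epsilon> E) / (\<mu> \<epsilon> y / mass \<epsilon> E) = \<mu> \<epsilon> x / \<mu> \<epsilon> y) (at_right 0)"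
    using mass_pos[OF _ E] by (intro eventually_pos) (simp add: less_imp_neq[symmetric])
  ultimately show ?thesis by (rule Lim_transform_eventually)
qed

text \<open>By \<open>capacity_symmetric\<close>, the escape probability from \<open>y\<close> to \<open>z\<close> times \<open>\<mu> \<epsilon> y\<close> equals the escape
  probability from \<open>z\<close> to \<open>y\<close> times \<open>\<mu> \<epsilon> z\<close>, and the latter does not depend on \<open>y \<in> E\<close> up to a factor
  \<open>1 + o(1)\<close>.\<close>
lemma escape_ratio_limit:
  assumes E: "E \<in> classes" and x: "x \<in> E" and y: "y \<in> E" and z: "z \<in> S - E"
  shows "((\<lambda>\<epsilon>. entry_prob S (P \<epsilon>) {y, z} {z} y / entry_prob S (P \<epsilon>) {x, z} {z} x)
    \<longlongrightarrow> \<nu> E x / \<nu> E y) (at_right 0)"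
proof -
  let ?b = "\<lambda>\<epsilon> y. entry_prob S (P \<epsilon>) {z, y} {y} z / entry_prob S (P \<epsilon>) (E \<union> {z}) E z"
  have "((\<lambda>\<epsilon>. \<mu> \<epsilon> x / \<mu> \<epsilon> y * (?b \<epsilon> y / ?b \<epsilon> x)) \<longlongrightarrow> \<nu> E x / \<nu> E y * (1 / 1)) (at_right 0)"
    using z by (intro tendsto_mult tendsto_divide conditioned_stat_ratio_limit
        entry_prob_point_equiv_set E x y) auto
  moreover have "eventually (\<lambda>\<epsilon>. \<mu> \<epsilon> x / \<mu> \<epsilon> y * (?b \<epsilon> y / ?b \<epsilon> x) =
      entry_prob S (P \<epsilon>) {y, z} {z} y / entry_prob S (P \<epsilon>) {x, z} {z} x) (at_right 0)"
  proof (rule eventually_pos)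
    fix \<epsilon> :: real assume \<epsilon>: "0 < \<epsilon>"
    then interpret irreducible_finite_chain S "P \<epsilon>" by (rule irreducible)
    have S: "x \<in> S" "y \<in> S" "z \<in> S" "x \<noteq> z" "y \<noteq> z" using x y z class_subset[OF E] by auto
    define kx ky hx hy r where "kx = entry_prob S (P \<epsilon>) {x, z} {z} x"
      and "ky = entry_prob S (P \<epsilon>) {y, z} {z} y"
      and "hx = entry_prob S (P \<epsilon>) {z, x} {x} z" and "hy = entry_prob S (P \<epsilon>) {z, y} {y} z"
      and "r = entry_prob S (P \<epsilon>) (E \<union> {z}) E z"
    have cap: "\<mu> \<epsilon> x * kx = \<mu> \<epsilon> z * hx" "\<mu> \<epsilon> y * ky = \<mu> \<epsilon> z * hy"
      using capacity_symmetric[OF stat[OF \<epsilon>], of x z] capacity_symmetric[OF stat[OF \<epsilon>], of y z] S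
      by (simp_all add: kx_def ky_def hx_def hy_def insert_commute)
    have pos: "0 < kx" "0 < hx" "0 < r" "0 < \<mu> \<epsilon> x" "0 < \<mu> \<epsilon> y" "0 < \<mu> \<epsilon> z"
      unfolding kx_def hx_def r_def
      using S z x class_subset[OF E] by (auto intro!: entry_prob_pos stat_pos[OF \<epsilon>])
    have "hy / hx = (\<mu> \<epsilon> z * hy) / (\<mu> \<epsilon> z * hx)"
      using pos by simp
    then have "hy / hx = (\<mu> \<epsilon> y * ky) / (\<mu> \<epsilon> x * kx)"
      by (simp only: cap)
    moreover have "(hy / r) / (hx / r) = hy / hx"
      using pos by simp
    ultimately show "\<mu> \<epsilon> x / \<mu> \<epsilon> y * (?b \<epsilon> y / ?b \<epsilon> x) =
        entry_prob S (P \<epsilon>) {y, z} {z} y / entry_prob S (P \<epsilon>) {x, z} {z} x"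
      unfolding kx_def[symmetric] ky_def[symmetric] hx_def[symmetric] hy_def[symmetric] r_def[symmetric]
      using pos by simp
  qed
  ultimately have "((\<lambda>\<epsilon>. entry_prob S (P \<epsilon>) {y, z} {z} y / entry_prob S (P \<epsilon>) {x, z} {z} x)
      \<longlongrightarrow> \<nu> E x / \<nu> E y * (1 / 1)) (at_right 0)"
    by (rule Lim_transform_eventually)
  then show ?thesis by simp
qed

text \<open>With \<open>k\<close> and \<open>q\<close> as defined in the proof,
  \<open>\<nu> E y * k \<epsilon> y\<close> is asymptotically the same for all \<open>y\<close> in
  \<open>E\<close>, and \<open>q \<epsilon> y\<close> behaves like \<open>k \<epsilon> y\<close>.
  Each summand of the rate is thus about \<open>\<nu> E y\<close> times
  \<open>\<nu> E x * k \<epsilon> x\<close>, and the weights \<open>\<nu> E y\<close> sum to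
  1.\<close>

lemma escape_equiv_eff_rate:
  assumes E: "E \<in> classes" "E' \<in> classes" "E \<noteq> E'" and x: "x \<in> E" and z: "z \<in> E'"
  shows "(\<lambda>\<epsilon>. \<nu> E x * entry_prob S (P \<epsilon>) {x, z} {z} x) \<simeq> (\<lambda>\<epsilon>. eff_rate S (P 0) (P \<epsilon>) E E')"
proof -
  have disj: "E \<inter> E' = {}" using E by (rule chain0.essential_classes_disjoint)
  have sub: "E \<subseteq> S" "E' \<subseteq> S" using E class_subset by auto
  define k where "k \<epsilon> y = entry_prob S (P \<epsilon>) {y, z} {z} y" for \<epsilon> y
  define q where "q \<epsilon> y = entry_prob S (P \<epsilon>) (E' \<union> {y}) E' y" for \<epsilon> y
  have rate: "eff_rate S (P 0) (P \<epsilon>) E E' = (\<Sum>y\<in>E. (\<nu> E y)\<^sup>2 * q \<epsilon> y)" for \<epsilon>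
    unfolding eff_rate_def q_def using disj
    by (intro sum.cong refl) (subst hit_before_prob_eq_entry_prob, auto)
  have k_pos: "0 < k \<epsilon> y" and q_pos: "0 < q \<epsilon> y" if "0 < \<epsilon>" "y \<in> E" for \<epsilon> y
  proof -
    interpret irreducible_finite_chain S "P \<epsilon>" by (rule irreducible) fact
    show "0 < k \<epsilon> y" unfolding k_def using that z disj sub by (intro entry_prob_pos) auto
    show "0 < q \<epsilon> y" unfolding q_def using that z disj sub by (intro entry_prob_pos) auto
  qed
  have rate_pos: "0 < eff_rate S (P 0) (P \<epsilon>) E E'" if "0 < \<epsilon>" for \<epsilon>
    unfolding rate using class_finite[OF E(1)] x class_stat_pos[OF E(1)] q_pos[OF that]
    by (intro sum_pos mult_pos_pos zero_less_power) auto
  \<comment> \<open>The quotient equals \<open>q \<epsilon> y / k \<epsilon> x\<close>, written so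
    that numerator and denominator have known limits.\<close>
  have q_lim: "((\<lambda>\<epsilon>. (k \<epsilon> y / k \<epsilon> x) / (k \<epsilon> y / q \<epsilon> y)) \<longlongrightarrow> (\<nu> E x / \<nu> E y) / 1) (at_right 0)"
    if "y \<in> E" for y
    unfolding k_def q_def using that x z E disj sub
    by (intro tendsto_divide escape_ratio_limit entry_prob_point_equiv_set) auto
  have "((\<lambda>\<epsilon>. \<Sum>y\<in>E. (\<nu> E y)\<^sup>2 / \<nu> E x * ((k \<epsilon> y / k \<epsilon> x) / (k \<epsilon> y / q \<epsilon> y))) \<longlongrightarrow>
      (\<Sum>y\<in>E. (\<nu> E y)\<^sup>2 / \<nu> E x * ((\<nu> E x / \<nu> E y) / 1))) (at_right 0)"
    by (intro tendsto_sum tendsto_mult tendsto_const q_lim)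
  also have "(\<Sum>y\<in>E. (\<nu> E y)\<^sup>2 / \<nu> E x * ((\<nu> E x / \<nu> E y) / 1)) = (\<Sum>y\<in>E. \<nu> E y)"
    using class_stat_pos[OF E(1)] x by (intro sum.cong) (auto simp: power2_eq_square less_imp_neq[symmetric])
  also have "\<dots> = 1" using class_stat[OF E(1)] by (simp add: stationary_def)
  \<comment> \<open>The sum is the reciprocal of the quotient asked for, hence the inverse.\<close>
  finally have "((\<lambda>\<epsilon>. inverse (\<Sum>y\<in>E. (\<nu> E y)\<^sup>2 / \<nu> E x * ((k \<epsilon> y / k \<epsilon> x) / (k \<epsilon> y / q \<epsilon> y))))
      \<longlongrightarrow> inverse 1) (at_right 0)"
    by (intro tendsto_inverse) auto
  moreover have "eventually (\<lambda>\<epsilon>.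
      inverse (\<Sum>y\<in>E. (\<nu> E y)\<^sup>2 / \<nu> E x * ((k \<epsilon> y / k \<epsilon> x) / (k \<epsilon> y / q \<epsilon> y))) =
      \<nu> E x * k \<epsilon> x / eff_rate S (P 0) (P \<epsilon>) E E') (at_right 0)"
  proof (rule eventually_pos)
    fix \<epsilon> :: real assume \<epsilon>: "0 < \<epsilon>"
    have "(\<Sum>y\<in>E. (\<nu> E y)\<^sup>2 / \<nu> E x * ((k \<epsilon> y / k \<epsilon> x) / (k \<epsilon> y / q \<epsilon> y))) =
        (\<Sum>y\<in>E. (\<nu> E y)\<^sup>2 * q \<epsilon> y / (\<nu> E x * k \<epsilon> x))"
    proof (intro sum.cong refl)
      fix y assume "y \<in> E"
      then show "(\<nu> E y)\<^sup>2 / \<nu> E x * ((k \<epsilon> y / k \<epsilon> x) / (k \<epsilon> y / q \<epsilon> y)) =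
          (\<nu> E y)\<^sup>2 * q \<epsilon> y / (\<nu> E x * k \<epsilon> x)"
        using k_pos[OF \<epsilon>, of y] by simp
    qed
    then show "inverse (\<Sum>y\<in>E. (\<nu> E y)\<^sup>2 / \<nu> E x * ((k \<epsilon> y / k \<epsilon> x) / (k \<epsilon> y / q \<epsilon> y))) =
        \<nu> E x * k \<epsilon> x / eff_rate S (P 0) (P \<epsilon>) E E'"
      by (simp add: rate sum_divide_distrib[symmetric])
  qed
  ultimately have "((\<lambda>\<epsilon>. \<nu> E x * k \<epsilon> x / eff_rate S (P 0) (P \<epsilon>) E E') \<longlongrightarrow> inverse 1) (at_right 0)"
    by (rule Lim_transform_eventually)
  then show ?thesis
    unfolding asymp_eq_def k_def using rate_pos by (intro disjI2 conjI exI[of _ 1]) auto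
qed

end

section \<open>Asymptotics of the effective representation\<close>

lemma asymp_eq_cong:
  assumes "a \<simeq> b" "\<And>\<epsilon>. 0 < \<epsilon> \<Longrightarrow> a' \<epsilon> = a \<epsilon>"
  shows "a' \<simeq> b"
proof -
  have "eventually (\<lambda>\<epsilon>. a' \<epsilon> / b \<epsilon> = a \<epsilon> / b \<epsilon>) (at_right 0)"
    using eventually_at_right_less[of "0::real"] by eventually_elim (simp add: assms(2))
  then have "((\<lambda>\<epsilon>. a' \<epsilon> / b \<epsilon>) \<longlongrightarrow> 1) (at_right 0) \<longleftrightarrow> ((\<lambda>\<epsilon>. a \<epsilon> / b \<epsilon>) \<longlongrightarrow> 1) (at_right 0)"
    by (rule tendsto_cong)
  then show ?thesis
    using assms unfolding asymp_eq_def by simp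
qed

theorem theorem4p3:
  fixes S S0 :: "'a set"
    and P :: "real \<Rightarrow> 'a \<Rightarrow> 'a \<Rightarrow> real"
    and n :: nat
    and E :: "nat \<Rightarrow> 'a set"
    and x :: "nat \<Rightarrow> 'a"
    and Phat :: "real \<Rightarrow> 'a \<Rightarrow> 'a \<Rightarrow> real"
  assumes "irreducibly_perturbed_chain S P"
    and "bij_betw E {1..n} (essential_classes S (P 0))"
    and "\<And>i. i \<in> {1..n} \<Longrightarrow> x i \<in> E i"
    and "S0 = x ` {1..n}"
    and "\<And>\<epsilon>. Phat \<epsilon> = eff_repr S (P 0) (P \<epsilon>) S0"
  shows "(\<forall>i\<in>{1..n}. \<forall>j\<in>{1..n}. i \<noteq> j \<longrightarrow>
            (\<lambda>\<epsilon>. hit_before_prob S0 (Phat \<epsilon>) (x i) {x j} {x i})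
              \<simeq> (\<lambda>\<epsilon>. eff_rate S (P 0) (P \<epsilon>) (E i) (E j)))
       \<and> (\<forall>i\<in>{1..n}.
            (\<lambda>\<epsilon>. stat_dist S0 (Phat \<epsilon>) (x i)) \<simeq> (\<lambda>\<epsilon>. \<Sum>y\<in>E i. stat_dist S (P \<epsilon>) y))"
proof (cases "n = 0")
  \<comment> \<open>A class exists, so \<open>S\<close> and \<open>S0\<close> are nonempty, as the
    irreducible chain locale demands. For \<open>n = 0\<close> both claims range over an empty index
    set.\<close>
  case False
  have P: "finite S" "\<And>\<epsilon>. 0 \<le> \<epsilon> \<Longrightarrow> stochastic S (P \<epsilon>)" "\<And>\<epsilon>. 0 < \<epsilon> \<Longrightarrow> irreducible_chain S (P \<epsilon>)"
    "\<And>x y. x \<in> S \<Longrightarrow> y \<in> S \<Longrightarrow> ((\<lambda>\<epsilon>. P \<epsilon> x y) \<longlongrightarrow> P 0 x y) (at_right 0)"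
    using assms(1) by (auto simp: irreducibly_perturbed_chain_def perturbed_chain_def)
  have Ei: "E i \<in> essential_classes S (P 0)" if "i \<in> {1..n}" for i
    using assms(2) that by (auto simp: bij_betw_def)
  have S_ne: "S \<noteq> {}"
    using Ei[of 1] False by (auto simp: essential_classes_def)
  interpret perturbed_irreducible_chain S P
  proof (rule perturbed_irreducible_chain.intro)
    show "finite_chain S (P 0)" using P by unfold_locales auto
    show "irreducible_finite_chain S (P \<epsilon>)" if "0 < \<epsilon>" for \<epsilon>
      using P S_ne that by (intro irreducible_finite_chainI) auto
  qed (rule P)
  have E_ne: "E i \<noteq> E j" if "i \<in> {1..n}" "j \<in> {1..n}" "i \<noteq> j" for i j
    using inj_on_contraD[OF bij_betw_imp_inj_on[OF assms(2)] that(3,1,2)] .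
  have x_ne: "x i \<noteq> x j" if "i \<in> {1..n}" "j \<in> {1..n}" "i \<noteq> j" for i j
    using chain0.essential_classes_disjoint[OF Ei[OF that(1)] Ei[OF that(2)] E_ne[OF that]]
      assms(3)[OF that(1)] assms(3)[OF that(2)] by auto
  then have inj: "inj_on x {1..n}" unfolding inj_on_def by blast
  have S0: "S0 \<subseteq> S" "S0 \<noteq> {}" "finite S0"
  proof -
    show "S0 \<subseteq> S"
      unfolding assms(4) using assms(3) class_subset[OF Ei] by blast
  qed (use False in \<open>auto simp: assms(4)\<close>)
  \<comment> \<open>The slowing factor in \<open>eff_repr\<close>, as a function of the state alone
    so that the lemmas on slowed traces apply to \<open>Phat\<close>.\<close>
  define f where "f u = \<nu> (comm_class S (P 0) u) u" for u
  have f_x: "f (x i) = \<nu> (E i) (x i)" if "i \<in> {1..n}" for i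
    using that by (simp add: f_def chain0.comm_class_essential[OF Ei assms(3)])
  have f: "0 < f u" "f u \<le> 1" if "u \<in> S0" for u
    using that class_stat_pos[OF Ei assms(3)] class_stat_le_1[OF Ei assms(3)]
    by (auto simp: assms(4) f_x)
  have Q: "Phat \<epsilon> u v = f u * entry_prob S (P \<epsilon>) S0 {v} u + (if u = v then 1 - f u else 0)"
    if "v \<in> S0" for \<epsilon> u v
    by (simp add: assms(5) eff_repr_def f_def Let_def hit_prob_eq_entry_prob[OF that])
  show ?thesis
  proof (intro conjI ballI impI)
    fix i j assume ij: "i \<in> {1..n}" "j \<in> {1..n}" "i \<noteq> j"
    have "hit_before_prob S0 (Phat \<epsilon>) (x i) {x j} {x i} =
        \<nu> (E i) (x i) * entry_prob S (P \<epsilon>) {x i, x j} {x j} (x i)" if \<epsilon>: "0 < \<epsilon>" for \<epsilon>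
    proof -
      interpret irreducible_finite_chain S "P \<epsilon>" by (rule irreducible[OF \<epsilon>])
      have "hit_before_prob S0 (Phat \<epsilon>) (x i) {x j} {x i} = entry_prob S0 (Phat \<epsilon>) {x i, x j} {x j} (x i)"
        using x_ne[OF ij] by (subst hit_before_prob_eq_entry_prob) (auto simp: insert_commute)
      also have "\<dots> = f (x i) * entry_prob S (P \<epsilon>) {x i, x j} {x j} (x i)"
        using S0 ij x_ne[OF ij] f Q by (intro slowed_trace_entry_prob) (auto simp: assms(4))
      finally show ?thesis using f_x[OF ij(1)] by simp
    qed
    then show "(\<lambda>\<epsilon>. hit_before_prob S0 (Phat \<epsilon>) (x i) {x j} {x i})
        \<simeq> (\<lambda>\<epsilon>. eff_rate S (P 0) (P \<epsilon>) (E i) (E j))"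
      using ij E_ne assms(3) by (intro asymp_eq_cong[OF escape_equiv_eff_rate[OF Ei Ei]]) auto
  next
    fix i assume i: "i \<in> {1..n}"
    \<comment> \<open>Normalising constant of the invariant weights
      \<open>\<mu> \<epsilon> u / f u\<close> of \<open>Phat \<epsilon>\<close>.\<close>
    define Z where "Z \<epsilon> = (\<Sum>u\<in>S0. \<mu> \<epsilon> u / f u)" for \<epsilon>
    have ratio: "((\<lambda>\<epsilon>. \<mu> \<epsilon> (x j) / mass \<epsilon> (E j) / f (x j)) \<longlongrightarrow> 1) (at_right 0)" if j: "j \<in> {1..n}" for j
    proof -
      have "((\<lambda>\<epsilon>. \<mu> \<epsilon> (x j) / mass \<epsilon> (E j) / f (x j)) \<longlongrightarrow> \<nu> (E j) (x j) / f (x j)) (at_right 0)"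
        using f[of "x j"] j assms(3)
        by (intro tendsto_divide tendsto_const conditioned_stat_limit Ei) (auto simp: assms(4))
      then show ?thesis using f[of "x j"] j by (simp add: f_x assms(4))
    qed
    \<comment> \<open>The masses of single classes need not converge. Each summand of
      \<open>Z \<epsilon>\<close> is written as the mass of its class plus an error; the errors tend
      to 0 because masses are at most 1, and the masses together tend to 1.\<close>
    have "((\<lambda>\<epsilon>. (\<mu> \<epsilon> (x j) / mass \<epsilon> (E j) / f (x j) - 1) * mass \<epsilon> (E j)) \<longlongrightarrow> 0) (at_right 0)"
      if j: "j \<in> {1..n}" for j
    proof (rule Lim_null_comparison)
      show "((\<lambda>\<epsilon>. \<bar>\<mu> \<epsilon> (x j) / mass \<epsilon> (E j) / f (x j) - 1\<bar>) \<longlongrightarrow> 0) (at_right 0)"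
        using ratio[OF j] by (intro tendsto_rabs_zero) (simp add: LIM_zero_iff)
      show "eventually (\<lambda>\<epsilon>. norm ((\<mu> \<epsilon> (x j) / mass \<epsilon> (E j) / f (x j) - 1) * mass \<epsilon> (E j))
          \<le> \<bar>\<mu> \<epsilon> (x j) / mass \<epsilon> (E j) / f (x j) - 1\<bar>) (at_right 0)"
        using mass_pos[OF _ Ei[OF j]] mass_le_1[OF _ Ei[OF j]]
        by (intro eventually_pos) (auto simp: abs_mult abs_of_pos intro!: mult_left_le)
    qed
    then have "((\<lambda>\<epsilon>. (\<Sum>j=1..n. (\<mu> \<epsilon> (x j) / mass \<epsilon> (E j) / f (x j) - 1) * mass \<epsilon> (E j)) +
        (\<Sum>C\<in>classes. mass \<epsilon> C)) \<longlongrightarrow> (\<Sum>j=1..n. 0) + 1) (at_right 0)"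
      by (intro tendsto_add tendsto_sum classes_mass_limit)
    moreover have "eventually (\<lambda>\<epsilon>. (\<Sum>j=1..n. (\<mu> \<epsilon> (x j) / mass \<epsilon> (E j) / f (x j) - 1) * mass \<epsilon> (E j)) +
        (\<Sum>C\<in>classes. mass \<epsilon> C) = Z \<epsilon>) (at_right 0)"
    proof (rule eventually_pos)
      fix \<epsilon> :: real assume \<epsilon>: "0 < \<epsilon>"
      have "(\<Sum>C\<in>classes. mass \<epsilon> C) = (\<Sum>j=1..n. mass \<epsilon> (E j))"
        by (rule sum.reindex_bij_betw[OF assms(2), symmetric])
      moreover have "Z \<epsilon> = (\<Sum>j=1..n. \<mu> \<epsilon> (x j) / f (x j))"
        unfolding Z_def assms(4) sum.reindex[OF inj] by simp
      ultimately show "(\<Sum>j=1..n. (\<mu> \<epsilon> (x j) / mass \<epsilon> (E j) / f (x j) - 1) * mass \<epsilon> (E j)) +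
          (\<Sum>C\<in>classes. mass \<epsilon> C) = Z \<epsilon>"
        using mass_pos[OF \<epsilon> Ei]
        by (simp only: sum.distrib[symmetric]) (intro sum.cong refl, simp add: left_diff_distrib less_imp_neq[symmetric])
    qed
    ultimately have "(Z \<longlongrightarrow> (\<Sum>j=1..n. 0) + 1) (at_right 0)"
      by (rule Lim_transform_eventually)
    then have Z_lim: "(Z \<longlongrightarrow> 1) (at_right 0)" by simp
    have hat: "stat_dist S0 (Phat \<epsilon>) (x i) = \<mu> \<epsilon> (x i) / f (x i) / Z \<epsilon>" if \<epsilon>: "0 < \<epsilon>" for \<epsilon>
    proof -
      interpret irreducible_finite_chain S "P \<epsilon>" by (rule irreducible[OF \<epsilon>])
      interpret hat: irreducible_finite_chain S0 "Phat \<epsilon>"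
        using S0(1,2) f Q by (rule slowed_trace_irreducible)
      have "stationary S0 (Phat \<epsilon>) (\<lambda>u. \<mu> \<epsilon> u / f u / Z \<epsilon>)"
        unfolding Z_def using S0(1,2) stat[OF \<epsilon>] f Q by (rule slowed_trace_stationary)
      then show ?thesis
        by (rule hat.stat_dist_eq) (use i in \<open>simp add: assms(4)\<close>)
    qed
    have "((\<lambda>\<epsilon>. \<mu> \<epsilon> (x i) / mass \<epsilon> (E i) / f (x i) / Z \<epsilon>) \<longlongrightarrow> 1 / 1) (at_right 0)"
      by (intro tendsto_divide ratio i Z_lim) simp
    moreover have "eventually (\<lambda>\<epsilon>. \<mu> \<epsilon> (x i) / mass \<epsilon> (E i) / f (x i) / Z \<epsilon> =
        stat_dist S0 (Phat \<epsilon>) (x i) / mass \<epsilon> (E i)) (at_right 0)"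
      by (intro eventually_pos) (simp add: hat mult_ac)
    ultimately have "((\<lambda>\<epsilon>. stat_dist S0 (Phat \<epsilon>) (x i) / mass \<epsilon> (E i)) \<longlongrightarrow> 1 / 1) (at_right 0)"
      by (rule Lim_transform_eventually)
    then show "(\<lambda>\<epsilon>. stat_dist S0 (Phat \<epsilon>) (x i)) \<simeq> (\<lambda>\<epsilon>. mass \<epsilon> (E i))"
      unfolding asymp_eq_def using mass_pos[OF _ Ei[OF i]] by (intro disjI2 conjI exI[of _ 1]) auto
  qed
qed simp

end
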